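(* Let $n$ be a positive integer, let $k\in\{0,1,\dots,n-1\}$, and let $N$ be an even integer with $N\geq k$. Then the cardinality of $\mathcal{T}_{n}^{k}$ equals \[ \lim_{\varepsilon\to0}\,\varepsilon^{-\lfloor k/2\rfloor}\, \operatorname{Pf}\begin{pmatrix} O_{n}&B_{n}^{N}J_{n+N}\\ -J_{n+N}{}^t\!B_{n}^{N}&\bar L_{n+N}^{(n,k)}(\varepsilon) \end{pmatrix}. \]
   Context: $\mathcal{T}_n$ denotes the set of triangular shifted arrays $b=(b_{ij})_{1\leq i\leq j\leq n-1}$ of integers whose entries are $\leq n$, weakly decreasing along rows and columns, and such that all entries in row $i$ are $\geq n-i$. $\mathcal{T}_n^k$ is the subset of those $b$ with $b_{ij}=n$ for all entries in the first $n-1-k$ columns (i.e. all $b_{ij}$ with $j\leq n-1-k$). $O_n$ is the $n\times n$ zero matrix and $J_M=(\delta_{i,M+1-j})_{1\leq i,j\leq M}$. $B_n^N=(\binom{i}{j-i})_{0\leq i\leq n-1,\,0\leq j\leq n+N-1}$ (an $n\times(n+N)$ matrix). For integers $1\leq p\leq M$ and $0\leq k\leq M-p$, $\bar L_{M}^{(p,k)}(\varepsilon)$ is the $M\times M$ skew-symmetric matrix whose $(i,j)$ entry for $i<j$ is: if $k$ is even, $(-1)^{j-i-1}\varepsilon$ when $i\leq p+k$ and $(-1)^{j-i-1}$ when $i>p+k$; if $k$ is odd, $(-1)^{j-i-1}\varepsilon$ when $j\leq p+k$ and $(-1)^{j-i-1}$ when $j>p+k$. $\lfloor x\rfloor$ is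 the floor function and $\operatorname{Pf}$ the Pfaffian.
   Formalization: The lower right block L̄ of the Pfaffian is replaced by J L̄ᵗ J (J = J_{n+N}), i.e. L̄ reflected in its antidiagonal; as printed the formula fails, e.g. for n=1, k=0, N=2 the Pfaffian is ε, so the limit is 0 while there is exactly one array. *)

theory Defs
  imports "HOL-Combinatorics.Permutations" "Jordan_Normal_Form.Matrix"
begin

(* Sum over the perfect matchings {{p 0, p 1}, {p 2, p 3}, ...} of the index set, each written
   uniquely with p 0 < p 1, p 2 < p 3, ... and p 0 < p 2 < ....
   Meaningful for skew-symmetric matrices of even dimension only. *)
definition pfaffian :: "'a :: comm_ring_1 mat \<Rightarrow> 'a" where
  "pfaffian A = (let m = dim_row A div 2 in
     \<Sum>p | p permutes {0..<dim_row A} \<and>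
          (\<forall>i<m. p (2 * i) < p (2 * i + 1)) \<and>
          (\<forall>i j. i < j \<and> j < m \<longrightarrow> p (2 * i) < p (2 * j)).
       of_int (sign p) * (\<Prod>i<m. A $$ (p (2 * i), p (2 * i + 1))))"

definition shifted_cells :: "nat \<Rightarrow> (nat \<times> nat) set" where
  "shifted_cells n = {(i, j). 1 \<le> i \<and> i \<le> j \<and> j \<le> n - 1}"

(* Extensionality (a fixed value outside the cells) makes each array a single function. *)
definition T_arrays :: "nat \<Rightarrow> (nat \<times> nat \<Rightarrow> int) set" where
  "T_arrays n = {b \<in> extensional (shifted_cells n).
     (\<forall>(i, j) \<in> shifted_cells n. int n - int i \<le> b (i, j) \<and> b (i, j) \<le> int n) \<and>
     (\<forall>i j j'. (i, j) \<in> shifted_cells n \<and> (i, j') \<in> shifted_cells n \<and> j \<le> j'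
        \<longrightarrow> b (i, j') \<le> b (i, j)) \<and>
     (\<forall>i i' j. (i, j) \<in> shifted_cells n \<and> (i', j) \<in> shifted_cells n \<and> i \<le> i'
        \<longrightarrow> b (i', j) \<le> b (i, j))}"

definition T_arrays_k :: "nat \<Rightarrow> nat \<Rightarrow> (nat \<times> nat \<Rightarrow> int) set" where
  "T_arrays_k n k = {b \<in> T_arrays n.
     \<forall>(i, j) \<in> shifted_cells n. int j \<le> int n - 1 - int k \<longrightarrow> b (i, j) = int n}"

definition J_mat :: "nat \<Rightarrow> real mat" where
  "J_mat M = mat M M (\<lambda>(i, j). if i + j + 1 = M then 1 else 0)"

(* binom(i, j - i) is 0 for j < i, which truncated subtraction would turn into 1. *)
definition B_mat :: "nat \<Rightarrow> nat \<Rightarrow> real mat" where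
  "B_mat n N = mat n (n + N) (\<lambda>(i, j). if i \<le> j then of_nat (i choose (j - i)) else 0)"

(* Entry above the diagonal, with 1-based indices i < j. *)
definition L_bar_upper :: "nat \<Rightarrow> nat \<Rightarrow> real \<Rightarrow> nat \<Rightarrow> nat \<Rightarrow> real" where
  "L_bar_upper p k \<epsilon> i j =
     (if even k
      then (if i \<le> p + k then (-1) ^ (j - i - 1) * \<epsilon> else (-1) ^ (j - i - 1))
      else (if j \<le> p + k then (-1) ^ (j - i - 1) * \<epsilon> else (-1) ^ (j - i - 1)))"

definition L_bar :: "nat \<Rightarrow> nat \<Rightarrow> nat \<Rightarrow> real \<Rightarrow> real mat" where
  "L_bar M p k \<epsilon> = mat M M (\<lambda>(r, c).
     if r < c then L_bar_upper p k \<epsilon> (r + 1) (c + 1)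
     else if c < r then - L_bar_upper p k \<epsilon> (c + 1) (r + 1)
     else 0)"

(* The limit formula with lower right block L = L_bar M p k \<epsilon> itself, next to B J, is false: for
   n = 1, k = 0, N = 2 the Pfaffian is \<epsilon>, so the limit is 0, while there is exactly one array;
   for n = 3, k = 1, N = 2 it is 7 \<epsilon>, and there are five arrays. As J reverses the columns of B,
   the indices of L have to be reversed as well. The theorem therefore uses J L^t J, whose
   1-based (i,j) entry is the (M+1-j, M+1-i) entry of L; the transpose keeps the signs. *)

end

theory Submission
  imports Defs "Jordan_Normal_Form.Determinant"
begin

text \<open>
  Expanding the Pfaffian along its first \<open>n\<close> rows gives the sum, over the \<open>n\<close>-subsets \<open>I\<close> of the
  columns of \<open>B\<close>, of the minors of \<open>B\<close> on \<open>I\<close> times signed Pfaffians of the lower right block on the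
  complement of \<open>I\<close>. The signs \<open>(-1) ^ (j - i - 1)\<close> cancel those of the expansion, and what remains of
  the smaller Pfaffian is a single power of \<open>\<epsilon>\<close>, whose exponent is minimal, namely \<open>k div 2\<close>, exactly
  when \<open>I\<close> lies in the first \<open>n + k\<close> columns. So the limit is the sum of the minors with columns among
  the first \<open>n + k\<close>.

  For the count, put \<open>c i j = n - b i j\<close>. Deleting the main diagonals one after the other turns \<open>c\<close>
  into a chain of interlacing partitions (a Gelfand-Tsetlin pattern). The transposed partitions grow
  by vertical strips, and the minors of \<open>B\<close> satisfy the same recursion: row \<open>i\<close> of \<open>B\<close> is the
  coefficient sequence of \<open>x ^ i * (1 + x) ^ i\<close>, so each row arises from the previous one by
  multiplication with \<open>x * (1 + x)\<close>, and multilinearity in the columns moves every column by 1 or 2.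
\<close>

section \<open>Expansion of Pfaffians\<close>

text \<open>\<open>(-1)\<close> to the number of inversions. Defined for words over arbitrary
  numbers, not just for permutations of \<open>{0..<n}\<close>, so that it survives the deletion of
  entries in the recursions below.\<close>

primrec list_sign :: "nat list \<Rightarrow> int" where
  "list_sign [] = 1"
| "list_sign (x # xs) = (-1) ^ card {y \<in> set xs. y < x} * list_sign xs"

lemma list_sign_map:
  assumes "strict_mono_on (set xs) h"
  shows "list_sign (map h xs) = list_sign xs"
  using assms
proof (induction xs)
  case (Cons x xs)
  have mono: "h y < h x \<longleftrightarrow> y < x" if "y \<in> set xs" for y
    using that Cons.prems strict_mono_on_less[of "set (x # xs)" h y x] by auto
  have "inj_on h (set xs)"
    by (rule inj_on_subset[OF strict_mono_on_imp_inj_on[OF Cons.prems]]) auto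
  moreover have "{y \<in> set (map h xs). y < h x} = h ` {y \<in> set xs. y < x}"
    using mono by auto
  ultimately have "card {y \<in> set (map h xs). y < h x} = card {y \<in> set xs. y < x}"
    by (auto intro!: card_image elim: inj_on_subset)
  moreover have "list_sign (map h xs) = list_sign xs"
    using Cons.prems by (intro Cons.IH) (auto simp: strict_mono_on_def)
  ultimately show ?case by simp
qed simp

text \<open>Every value below \<open>p 0\<close> occurs later in the word, so the first entry causes
  \<open>p 0\<close> inversions, and \<open>sign\<close> picks up the same factor when
  \<open>0\<close> is deleted. What remains is the word of \<open>q\<close>, relabelled by the
  increasing map \<open>insert_index (p 0)\<close>.\<close>

lemma list_sign_permutation:
  assumes "p permutes {0..<n}"
  shows "list_sign (map p [0..<n]) = sign p"
  using assms
proof (induction n arbitrary: p)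
  case (Suc n)
  define q where "q = permutation_delete p 0"
  have q: "q permutes {0..<n}"
    unfolding q_def using Suc.prems by (rule permutation_delete_permutes) simp
  have pq: "p = permutation_insert 0 (p 0) q"
    unfolding q_def by (rule permutation_insert_delete[symmetric, OF Suc.prems]) simp
  have p0: "p 0 < Suc n"
    using permutes_in_image[OF Suc.prems, of 0] by simp
  have pS: "p (Suc i) = insert_index (p 0) (q i)" for i
    by (subst pq) (simp add: permutation_insert_expand insert_index_def)
  have "list_sign (map (insert_index (p 0)) (map q [0..<n])) = list_sign (map q [0..<n])"
    by (rule list_sign_map) (auto simp: strict_mono_on_def insert_index_def)
  also have "\<dots> = sign q" by (rule Suc.IH[OF q])
  finally have tail: "list_sign (map (\<lambda>i. p (Suc i)) [0..<n]) = sign q"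
    by (simp add: pS o_def)
  have "p ` {Suc 0..<Suc n} = p ` {0..<Suc n} - {p 0}"
  proof -
    have "{Suc 0..<Suc n} = {0..<Suc n} - {0}" by auto
    then show ?thesis
      using image_set_diff[OF permutes_inj[OF Suc.prems], of "{0..<Suc n}" "{0}"] by (simp only: image_insert image_empty)
  qed
  also have "\<dots> = {0..<Suc n} - {p 0}"
    using permutes_image[OF Suc.prems] by simp
  finally have "{y \<in> p ` {Suc 0..<Suc n}. y < p 0} = {0..<p 0}" using p0 by auto
  then have "card {y \<in> set (map p [Suc 0..<Suc n]). y < p 0} = p 0" by (simp del: upt_Suc)
  moreover have "map p [0..<Suc n] = p 0 # map p [Suc 0..<Suc n]"
    by (simp add: upt_conv_Cons del: upt_Suc)
  moreover have "map p [Suc 0..<Suc n] = map (\<lambda>i. p (Suc i)) [0..<n]"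
    by (simp add: map_Suc_upt[symmetric] del: upt_Suc)
  moreover have "sign p = (-1) ^ (p 0) * sign q"
    using signof_permutation_insert[OF q zero_less_Suc p0, where ?'a = int] pq by simp
  ultimately show ?case using tail by (simp del: upt_Suc)
qed simp

text \<open>The Pfaffian of \<open>f\<close> on an index set \<open>S\<close> with
  \<open>card S = 2 * m\<close>, as its expansion along the row of the smallest index. General index
  sets are needed because deleting a pair leaves gaps.\<close>

primrec pf :: "nat \<Rightarrow> (nat \<Rightarrow> nat \<Rightarrow> 'a::comm_ring_1) \<Rightarrow> nat set \<Rightarrow> 'a" where
  "pf 0 f S = 1"
| "pf (Suc m) f S = (\<Sum>c\<in>S - {Min S}. (-1) ^ card {x \<in> S. Min S < x \<and> x < c} *
     f (Min S) c * pf m f (S - {Min S, c}))"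

text \<open>Perfect matchings in the normal form of \<open>pfaffian\<close>, but as words: removing
  the first pair then leaves an object of the same kind.\<close>

definition matchings :: "nat \<Rightarrow> nat set \<Rightarrow> nat list set" where
  "matchings m S = {l. distinct l \<and> set l = S \<and>
     (\<forall>i<m. l ! (2 * i) < l ! (2 * i + 1)) \<and>
     (\<forall>i j. i < j \<and> j < m \<longrightarrow> l ! (2 * i) < l ! (2 * j))}"

text \<open>The first members of the pairs increase and each lies below its partner, so the first
  letter of the word is the smallest.\<close>

lemma matchings_Cons:
  assumes "card S = 2 * Suc m" and "x # c # l \<in> matchings (Suc m) S"
  shows "x = Min S" and "c \<in> S - {Min S}" and "l \<in> matchings m (S - {Min S, c})"
proof -
  let ?L = "x # c # l"
  from assms(2) have L: "distinct ?L" "set ?L = S"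
    and M1: "\<And>i. i < Suc m \<Longrightarrow> ?L ! (2 * i) < ?L ! (2 * i + 1)"
    and M2: "\<And>i j. i < j \<Longrightarrow> j < Suc m \<Longrightarrow> ?L ! (2 * i) < ?L ! (2 * j)"
    unfolding matchings_def by blast+
  have len: "length ?L = 2 * Suc m"
    using distinct_card[OF L(1)] L(2) assms(1) by simp
  have x_le: "x \<le> y" if y: "y \<in> S" for y
  proof -
    obtain j where j: "j < 2 * Suc m" "y = ?L ! j"
      using y L(2) len by (metis in_set_conv_nth)
    define i where "i = j div 2"
    have i: "j = 2 * i \<or> j = 2 * i + 1" unfolding i_def by presburger
    then have im: "i < Suc m" using j(1) by arith
    have "x \<le> ?L ! (2 * i)"
    proof (cases i)
      case (Suc i')
      then show ?thesis using M2[of 0 i] im by (simp del: mult_Suc_right)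
    qed simp
    then show ?thesis using i j(2) M1[OF im] by (metis less_imp_le order_trans)
  qed
  have "finite S" and "x \<in> S" using L(2) by auto
  then show x: "x = Min S" by (intro Min_eqI[symmetric] x_le)
  show "c \<in> S - {Min S}" using x L by auto
  have "l ! (2 * i) < l ! (2 * i + 1)" if "i < m" for i
    using M1[of "Suc i"] that by simp
  moreover have "l ! (2 * i) < l ! (2 * j)" if "i < j" "j < m" for i j
    using M2[of "Suc i" "Suc j"] that by simp
  ultimately show "l \<in> matchings m (S - {Min S, c})"
    using L x unfolding matchings_def by auto
qed

lemma matchings_ConsI:
  assumes "card S = 2 * Suc m" and c: "c \<in> S - {Min S}" and l: "l \<in> matchings m (S - {Min S, c})"
  shows "Min S # c # l \<in> matchings (Suc m) S"
proof -
  let ?L = "Min S # c # l"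
  have fin: "finite S" using assms(1) card.infinite by fastforce
  have minS: "Min S \<in> S" using fin c by (auto intro: Min_in)
  have min: "Min S < y" if "y \<in> S - {Min S}" for y
    using that fin by (simp add: order.not_eq_order_implies_strict)
  from l have l': "distinct l" "set l = S - {Min S, c}" unfolding matchings_def by blast+
  have "length l = card (S - {Min S, c})" using l' distinct_card by metis
  also have "\<dots> = card S - card {Min S, c}"
    by (rule card_Diff_subset) (use minS c in auto)
  \<comment> \<open>The length ensures that \<open>l ! (2 * j')\<close> below is a genuine letter of
    \<open>l\<close> and so an element of \<open>S\<close>.\<close>
  finally have len: "length l = 2 * m" using c assms(1) by (auto simp: card_insert_if)
  have "?L ! (2 * i) < ?L ! (2 * i + 1)" if "i < Suc m" for i
    using l that min[OF c] unfolding matchings_def by (cases i) auto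
  moreover have "?L ! (2 * i) < ?L ! (2 * j)" if ij: "i < j" "j < Suc m" for i j
  proof (cases i)
    case 0
    obtain j' where j': "j = Suc j'" using ij(1) by (cases j) auto
    with ij(2) have "l ! (2 * j') \<in> set l" by (intro nth_mem) (simp add: len)
    then have "Min S < l ! (2 * j')" using l'(2) min by blast
    then show ?thesis using 0 j' by simp
  next
    case (Suc i')
    then show ?thesis using l ij unfolding matchings_def by (cases j) auto
  qed
  ultimately show ?thesis using l' c minS unfolding matchings_def by auto
qed

lemma matchings_Suc:
  assumes "card S = 2 * Suc m"
  shows "matchings (Suc m) S =
    (\<lambda>(c, l). Min S # c # l) ` (SIGMA c:S - {Min S}. matchings m (S - {Min S, c}))"
proof (intro equalityI subsetI)
  fix L assume L: "L \<in> matchings (Suc m) S"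
  then have "length L = 2 * Suc m"
    using assms distinct_card unfolding matchings_def by fastforce
  then obtain x c l where "L = x # c # l"
    by (cases L; cases "tl L") auto
  with matchings_Cons[OF assms, of x c l] L
  show "L \<in> (\<lambda>(c, l). Min S # c # l) ` (SIGMA c:S - {Min S}. matchings m (S - {Min S, c}))"
    by auto
qed (auto intro: matchings_ConsI[OF assms])

lemma finite_matchings:
  assumes "finite S"
  shows "finite (matchings m S)"
  by (rule finite_subset[OF _ finite_subset_distinct[OF assms]]) (auto simp: matchings_def)

text \<open>Peel off the first pair: \<open>Min S\<close> starts no inversion, and \<open>c\<close>
  is inverted exactly with the elements of \<open>S\<close> strictly between the two, which is the
  sign in \<open>pf\<close>.\<close>

lemma pf_eq_sum_matchings:
  assumes "card S = 2 * m" "finite S"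
  shows "pf m f S =
    (\<Sum>l\<in>matchings m S. of_int (list_sign l) * (\<Prod>i<m. f (l ! (2 * i)) (l ! (2 * i + 1))))"
  using assms
proof (induction m arbitrary: S)
  case 0
  then have "matchings 0 S = {[]}" by (auto simp: matchings_def)
  then show ?case by simp
next
  case (Suc m)
  let ?t = "\<lambda>m l. of_int (list_sign l) * (\<Prod>i<m. f (l ! (2 * i)) (l ! (2 * i + 1)))"
  let ?\<Sigma> = "SIGMA c:S - {Min S}. matchings m (S - {Min S, c})"
  have "S \<noteq> {}" using Suc.prems by auto
  then have minS: "Min S \<in> S" using Suc.prems by simp
  have min: "Min S < y" if "y \<in> S - {Min S}" for y
    using that Suc.prems by (simp add: order.not_eq_order_implies_strict)
  have "(\<Sum>l\<in>matchings (Suc m) S. ?t (Suc m) l) = (\<Sum>(c, l)\<in>?\<Sigma>. ?t (Suc m) (Min S # c # l))"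
    unfolding matchings_Suc[OF Suc.prems(1)]
    by (subst sum.reindex) (auto simp: inj_on_def case_prod_unfold)
  also have "\<dots> = (\<Sum>c\<in>S - {Min S}. \<Sum>l\<in>matchings m (S - {Min S, c}). ?t (Suc m) (Min S # c # l))"
    by (rule sum.Sigma[symmetric]) (use Suc.prems in \<open>auto intro: finite_matchings\<close>)
  also have "\<dots> = pf (Suc m) f S"
    unfolding pf.simps
  proof (rule sum.cong[OF refl])
    fix c assume c: "c \<in> S - {Min S}"
    have card: "card (S - {Min S, c}) = 2 * m"
      using Suc.prems minS c by (subst card_Diff_subset) (auto simp: card_insert_if)
    have "?t (Suc m) (Min S # c # l) =
        (-1) ^ card {x \<in> S. Min S < x \<and> x < c} * f (Min S) c * ?t m l"
      if "l \<in> matchings m (S - {Min S, c})" for l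
    proof -
      have l: "set l = S - {Min S, c}" using that by (simp add: matchings_def)
      have "set (c # l) = S - {Min S}" unfolding list.set l using c by blast
      then have "{y \<in> set (c # l). y < Min S} = {}"
        using min less_asym by blast
      moreover have "{y \<in> set l. y < c} = {x \<in> S. Min S < x \<and> x < c}"
        unfolding l using min by blast
      ultimately have "list_sign (Min S # c # l) =
          (-1) ^ card {x \<in> S. Min S < x \<and> x < c} * list_sign l"
        by (simp only: list_sign.simps card.empty power_0 mult_1_left)
      moreover have "(\<Prod>i<Suc m. f ((Min S # c # l) ! (2 * i)) ((Min S # c # l) ! (2 * i + 1))) =
          f (Min S) c * (\<Prod>i<m. f (l ! (2 * i)) (l ! (2 * i + 1)))"
        by (subst prod.lessThan_Suc_shift) simp
      ultimately show ?thesis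
        by (simp only: of_int_mult of_int_power of_int_minus of_int_1 mult_ac)
    qed
    then have "(\<Sum>l\<in>matchings m (S - {Min S, c}). ?t (Suc m) (Min S # c # l)) =
        (\<Sum>l\<in>matchings m (S - {Min S, c}).
           (-1) ^ card {x \<in> S. Min S < x \<and> x < c} * f (Min S) c * ?t m l)"
      by (rule sum.cong[OF refl])
    also have "\<dots> = (-1) ^ card {x \<in> S. Min S < x \<and> x < c} * f (Min S) c *
        (\<Sum>l\<in>matchings m (S - {Min S, c}). ?t m l)"
      by (rule sum_distrib_left[symmetric])
    also have "(\<Sum>l\<in>matchings m (S - {Min S, c}). ?t m l) = pf m f (S - {Min S, c})"
      by (rule Suc.IH[symmetric, OF card]) (use Suc.prems in simp)
    finally show "(\<Sum>l\<in>matchings m (S - {Min S, c}). ?t (Suc m) (Min S # c # l)) =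
        (-1) ^ card {x \<in> S. Min S < x \<and> x < c} * f (Min S) c * pf m f (S - {Min S, c})" .
  qed
  finally show ?case ..
qed

section \<open>Permutations as words: the recursive Pfaffian agrees with
  \<open>pfaffian\<close>\<close>

lemma bij_betw_permutes_distinct_lists:
  "bij_betw (\<lambda>p. map p [0..<n]) {p. p permutes {0..<n}} {l. distinct l \<and> set l = {0..<n}}"
proof (rule bij_betwI')
  fix p q :: "nat \<Rightarrow> nat" assume pq: "p \<in> {p. p permutes {0..<n}}" "q \<in> {p. p permutes {0..<n}}"
  show "(map p [0..<n] = map q [0..<n]) = (p = q)"
  proof
    assume eq: "map p [0..<n] = map q [0..<n]"
    show "p = q"
    proof
      fix x show "p x = q x"
        using eq pq permutes_not_in[of p "{0..<n}" x] permutes_not_in[of q "{0..<n}" x]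
        by (cases "x < n") auto
    qed
  qed simp
next
  fix p :: "nat \<Rightarrow> nat" assume "p \<in> {p. p permutes {0..<n}}"
  then show "map p [0..<n] \<in> {l. distinct l \<and> set l = {0..<n}}"
    using permutes_image permutes_inj_on by (auto simp: distinct_map)
next
  fix l assume l: "l \<in> {l. distinct l \<and> set l = {0..<n}}"
  then have len: "length l = n" using distinct_card by fastforce
  define p where "p = (\<lambda>i. if i < n then l ! i else i)"
  have "bij_betw (\<lambda>i. l ! i) {0..<n} {0..<n}"
    using bij_betw_nth[of l "{0..<n}" "{0..<n}"] l len by (auto simp: atLeast0LessThan)
  then have "bij_betw p {0..<n} {0..<n}"
    by (rule bij_betw_cong[THEN iffD1, rotated]) (simp add: p_def)
  then have "p permutes {0..<n}" by (rule bij_imp_permutes) (simp add: p_def)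
  moreover have "l = map p [0..<n]" using len by (intro nth_equalityI) (auto simp: p_def)
  ultimately show "\<exists>p\<in>{p. p permutes {0..<n}}. l = map p [0..<n]" by blast
qed

theorem pfaffian_eq_pf:
  assumes "dim_row A = 2 * m"
  shows "pfaffian A = pf m (\<lambda>i j. A $$ (i, j)) {0..<2 * m}"
proof -
  let ?P = "{p. p permutes {0..<2 * m} \<and> (\<forall>i<m. p (2 * i) < p (2 * i + 1)) \<and>
     (\<forall>i j. i < j \<and> j < m \<longrightarrow> p (2 * i) < p (2 * j))}"
  have "bij_betw (\<lambda>p. map p [0..<2 * m]) ?P (matchings m {0..<2 * m})"
    (is "bij_betw ?h _ _")
  proof (rule bij_betw_subset[OF bij_betw_permutes_distinct_lists[of "2 * m"]])
    show "?h ` ?P = matchings m {0..<2 * m}"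
    proof (intro equalityI subsetI)
      fix l assume "l \<in> ?h ` ?P"
      then obtain p where p: "p \<in> ?P" and l: "l = ?h p" by blast
      then have "distinct l \<and> set l = {0..<2 * m}"
        using bij_betwE[OF bij_betw_permutes_distinct_lists[of "2 * m"]] by blast
      with p show "l \<in> matchings m {0..<2 * m}"
        unfolding matchings_def l by simp
    next
      fix l assume l: "l \<in> matchings m {0..<2 * m}"
      then have "l \<in> ?h ` {p. p permutes {0..<2 * m}}"
        unfolding bij_betw_imp_surj_on[OF bij_betw_permutes_distinct_lists[of "2 * m"]]
        by (simp add: matchings_def)
      then obtain p where p: "p permutes {0..<2 * m}" "l = ?h p" by blast
      have "p \<in> ?P" using l p(1) unfolding p(2) matchings_def by simp
      with p show "l \<in> ?h ` ?P" by blast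
    qed
  qed auto
  have "pfaffian A = (\<Sum>p\<in>?P. of_int (sign p) * (\<Prod>i<m. A $$ (p (2 * i), p (2 * i + 1))))"
    unfolding pfaffian_def assms Let_def by simp
  also have "\<dots> = (\<Sum>p\<in>?P. of_int (list_sign (?h p)) *
      (\<Prod>i<m. A $$ (?h p ! (2 * i), ?h p ! (2 * i + 1))))"
    by (rule sum.cong) (auto simp: list_sign_permutation)
  also have "\<dots> = (\<Sum>l\<in>matchings m {0..<2 * m}. of_int (list_sign l) *
      (\<Prod>i<m. A $$ (l ! (2 * i), l ! (2 * i + 1))))"
    by (rule sum.reindex_bij_betw) fact
  also have "\<dots> = pf m (\<lambda>i j. A $$ (i, j)) {0..<2 * m}"
    by (rule pf_eq_sum_matchings[symmetric]) auto
  finally show ?thesis .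
qed

section \<open>The lower right block\<close>

text \<open>\<open>S - {Min S, c}\<close> has even size, so the elements between
  \<open>Min S\<close> and \<open>c\<close> and those above \<open>c\<close> have the same parity.
  Counting from above becomes counting smaller columns once the order is reversed.\<close>

lemma pf_Suc_above:
  assumes "finite S" "card S = 2 * Suc m"
  shows "pf (Suc m) f S = (\<Sum>c\<in>S - {Min S}. (-1) ^ card {x \<in> S. c < x} *
     f (Min S) c * pf m f (S - {Min S, c}))"
  unfolding pf.simps
proof (rule sum.cong[OF refl])
  fix c assume c: "c \<in> S - {Min S}"
  have min: "Min S < y" if "y \<in> S - {Min S}" for y
    using that assms by (simp add: order.not_eq_order_implies_strict)
  have minS: "Min S \<in> S" using assms by (intro Min_in) auto
  have "S - {Min S, c} = {x \<in> S. Min S < x \<and> x < c} \<union> {x \<in> S. c < x}"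
  proof (rule Set.set_eqI)
    fix x show "x \<in> S - {Min S, c} \<longleftrightarrow> x \<in> {x \<in> S. Min S < x \<and> x < c} \<union> {x \<in> S. c < x}"
      using min[OF c] min[of x] by (cases x c rule: linorder_cases) auto
  qed
  moreover have "card (S - {Min S, c}) = 2 * m"
    using assms minS c by (subst card_Diff_subset) (auto simp: card_insert_if)
  moreover have "card ({x \<in> S. Min S < x \<and> x < c} \<union> {x \<in> S. c < x}) =
      card {x \<in> S. Min S < x \<and> x < c} + card {x \<in> S. c < x}"
    by (rule card_Un_disjoint) (use assms in auto)
  ultimately have "card {x \<in> S. Min S < x \<and> x < c} + card {x \<in> S. c < x} = 2 * m" by simp
  then have "even (card {x \<in> S. Min S < x \<and> x < c}) \<longleftrightarrow> even (card {x \<in> S. c < x})"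
    by presburger
  then have "(-1 :: 'a) ^ card {x \<in> S. Min S < x \<and> x < c} = (-1) ^ card {x \<in> S. c < x}"
    by (simp add: minus_one_power_iff)
  then show "(-1) ^ card {x \<in> S. Min S < x \<and> x < c} * f (Min S) c * pf m f (S - {Min S, c}) =
      (-1) ^ card {x \<in> S. c < x} * f (Min S) c * pf m f (S - {Min S, c})" by simp
qed

text \<open>In increasing order of \<open>c\<close> the terms are 1, -1, 1, and so on, so they
  cancel in pairs.\<close>

lemma sum_alternating_rank:
  fixes A :: "'a::linorder set"
  assumes "finite A"
  shows "(\<Sum>c\<in>A. (-1) ^ card {x \<in> A. x < c}) = (if even (card A) then 0 else 1 :: 'b::comm_ring_1)"
  using assms
proof (induction rule: finite_linorder_max_induct)
  case (insert b A)
  have "{x \<in> insert b A. x < c} = {x \<in> A. x < c}" if "c \<in> A" for c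
    using insert.hyps(2) that by auto
  moreover have "{x \<in> insert b A. x < b} = A" using insert.hyps(2) by auto
  moreover have "b \<notin> A" using insert.hyps(2) by auto
  ultimately show ?case using insert by (auto simp: minus_one_power_iff)
qed simp

text \<open>For \<open>i < j\<close> this is, up to the sign \<open>(-1) ^ (j - i - 1)\<close>, the entry of \<open>L_bar M n k \<epsilon>\<close> with
  0-based indices \<open>(i, j)\<close>, when \<open>b = n + k\<close>.\<close>

definition weight :: "nat \<Rightarrow> nat \<Rightarrow> real \<Rightarrow> nat \<Rightarrow> nat \<Rightarrow> real" where
  "weight k b \<epsilon> i j = (if (if even k then i < b else j < b) then \<epsilon> else 1)"

text \<open>With \<open>a\<close> indices below \<open>b\<close>, paired off among themselves as far
  as possible, this is the number of pairs carrying \<epsilon>: pairs meeting the low part for even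
  \<open>k\<close>, pairs inside it for odd \<open>k\<close>.\<close>

definition low_exponent :: "nat \<Rightarrow> nat \<Rightarrow> nat" where
  "low_exponent k a = (if even k then (a + 1) div 2 else a div 2)"

text \<open>One step of the expansion, along the largest column \<open>M\<close>. Up to sign the
  summand is constant for \<open>c\<close> below \<open>b\<close> and constant for the other
  \<open>c\<close>, so each of the two alternating sums collapses to 0 or 1. Their lengths add up to
  an odd number, hence exactly one of them survives.\<close>

lemma sum_weight:
  assumes K: "finite K" "card K = 2 * Suc m" and M: "M = Max K"
  shows "(\<Sum>c\<in>K - {M}. (-1) ^ card {x \<in> K. x < c} *
      (weight k b \<epsilon> c M * \<epsilon> ^ low_exponent k (card {x \<in> K - {c, M}. x < b}))) =
    \<epsilon> ^ low_exponent k (card {x \<in> K. x < b})"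
    (is "?lhs = ?rhs")
proof -
  let ?A = "{x \<in> K - {M}. x < b}" and ?B = "{x \<in> K - {M}. \<not> x < b}"
  have MK: "M \<in> K" using K unfolding M by (intro Max_in) auto
  have below: "x \<le> M" if "x \<in> K" for x using K that unfolding M by simp
  have KM: "K - {M} = ?A \<union> ?B" by auto
  have rankA: "{x \<in> K. x < c} = {x \<in> ?A. x < c}" if "c \<in> ?A" for c
    using that below[of c] by auto
  have rankB: "card {x \<in> K. x < c} = card ?A + card {x \<in> ?B. x < c}" if "c \<in> ?B" for c
  proof -
    have "{x \<in> K. x < c} = ?A \<union> {x \<in> ?B. x < c}"
      using that below[of c] by auto
    then show ?thesis by (simp only:) (rule card_Un_disjoint, use K in auto)
  qed
  have cardAB: "card ?A + card ?B = 2 * m + 1"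
  proof -
    have "card ?A + card ?B = card (K - {M})"
      by (subst KM, rule card_Un_disjoint[symmetric]) (use K in auto)
    then show ?thesis using K MK by simp
  qed
  define a where "a = card ?A"
  have low: "card {x \<in> K. x < b} = (if M < b then a + 1 else a)"
  proof (cases "M < b")
    case True
    then have "{x \<in> K. x < b} = insert M ?A" using MK by auto
    then show ?thesis using True K by (simp add: a_def)
  next
    case False
    then have "{x \<in> K. x < b} = ?A" by auto
    then show ?thesis using False by (simp add: a_def)
  qed
  have lowA: "card {x \<in> K - {c, M}. x < b} = a - 1" if "c \<in> ?A" for c
  proof -
    have "{x \<in> K - {c, M}. x < b} = ?A - {c}" by auto
    then show ?thesis using that K by (simp add: a_def)
  qed
  have lowB: "card {x \<in> K - {c, M}. x < b} = a" if "c \<in> ?B" for c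
  proof -
    have "{x \<in> K - {c, M}. x < b} = ?A" using that by auto
    then show ?thesis by (simp add: a_def)
  qed
  let ?wA = "(if even k \<or> M < b then \<epsilon> else 1) * \<epsilon> ^ low_exponent k (a - 1)"
  let ?wB = "(if odd k \<and> M < b then \<epsilon> else 1) * \<epsilon> ^ low_exponent k a"
  have "?lhs = (\<Sum>c\<in>?A. (-1) ^ card {x \<in> K. x < c} *
      (weight k b \<epsilon> c M * \<epsilon> ^ low_exponent k (card {x \<in> K - {c, M}. x < b}))) +
    (\<Sum>c\<in>?B. (-1) ^ card {x \<in> K. x < c} *
      (weight k b \<epsilon> c M * \<epsilon> ^ low_exponent k (card {x \<in> K - {c, M}. x < b})))"
    by (subst KM, rule sum.union_disjoint) (use K in auto)
  also have "\<dots> = (\<Sum>c\<in>?A. (-1) ^ card {x \<in> ?A. x < c} * ?wA) +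
      (\<Sum>c\<in>?B. (-1) ^ a * (-1) ^ card {x \<in> ?B. x < c} * ?wB)"
  proof (intro arg_cong2[where f = "(+)"] sum.cong refl)
    fix c assume c: "c \<in> ?A"
    then have "weight k b \<epsilon> c M = (if even k \<or> M < b then \<epsilon> else 1)"
      by (auto simp: weight_def)
    then show "(-1) ^ card {x \<in> K. x < c} *
      (weight k b \<epsilon> c M * \<epsilon> ^ low_exponent k (card {x \<in> K - {c, M}. x < b})) =
      (-1) ^ card {x \<in> ?A. x < c} * ?wA"
      by (simp only: rankA[OF c] lowA[OF c])
  next
    fix c assume c: "c \<in> ?B"
    then have "weight k b \<epsilon> c M = (if odd k \<and> M < b then \<epsilon> else 1)"
      by (auto simp: weight_def)
    then show "(-1) ^ card {x \<in> K. x < c} *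
      (weight k b \<epsilon> c M * \<epsilon> ^ low_exponent k (card {x \<in> K - {c, M}. x < b})) =
      (-1) ^ a * (-1) ^ card {x \<in> ?B. x < c} * ?wB"
      by (simp only: rankB[OF c] lowB[OF c] power_add a_def)
  qed
  also have "\<dots> = (if even a then 0 else 1) * ?wA + (-1) ^ a * (if even (card ?B) then 0 else 1) * ?wB"
  proof -
    have "(\<Sum>c\<in>?A. (-1) ^ card {x \<in> ?A. x < c}) = (if even a then 0 else 1 :: real)"
      unfolding a_def by (rule sum_alternating_rank) (use K in simp)
    moreover have "(\<Sum>c\<in>?B. (-1) ^ card {x \<in> ?B. x < c}) = (if even (card ?B) then 0 else 1 :: real)"
      by (rule sum_alternating_rank) (use K in simp)
    ultimately show ?thesis by (simp only: sum_distrib_right[symmetric] sum_distrib_left[symmetric])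
  qed
  also have "\<dots> = ?rhs"
  proof (cases "M < b")
    case True
    then have "?B = {}" using below by fastforce
    then have B: "card ?B = 0" by (simp only: card.empty)
    \<comment> \<open>All of \<open>K\<close> is low, so \<open>a\<close> is odd and only the sum
      over \<open>?A\<close> is left.\<close>
    then have a: "a = 2 * m + 1" using cardAB unfolding a_def by linarith
    show ?thesis using True unfolding low a low_exponent_def B
      by (auto simp: power_Suc[symmetric] simp del: power_Suc)
  next
    case False
    \<comment> \<open>For odd \<open>a\<close> only \<open>?A\<close> survives, and its extra factor
      \<epsilon> for even \<open>k\<close> makes up for \<open>a - 1\<close> in the exponent. For
      even \<open>a\<close> only \<open>?B\<close> survives, and its sign \<open>(-1) ^ a\<close> is
      1.\<close>
    have "even (card ?B) \<longleftrightarrow> odd a" using cardAB unfolding a_def by presburger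
    then show ?thesis using False unfolding low low_exponent_def
      by (auto elim!: evenE oddE simp: power_Suc[symmetric] simp del: power_Suc)
  qed
  finally show ?thesis .
qed

text \<open>As \<open>J\<close> reverses the order, column \<open>q\<close> of \<open>B\<close> ends up at the index \<open>t - q\<close> of the block matrix,
  where \<open>t\<close> is its last index. From here on, sets of such indices are described by the columns \<open>q\<close>.\<close>

lemma Min_reflect:
  fixes K :: "nat set"
  assumes "finite K" "K \<noteq> {}" "K \<subseteq> {..t}"
  shows "Min ((\<lambda>q. t - q) ` K) = t - Max K"
proof (rule Min_eqI)
  fix y assume "y \<in> (\<lambda>q. t - q) ` K"
  then obtain q where "q \<in> K" "y = t - q" by blast
  then show "t - Max K \<le> y" using Max_ge[OF assms(1)] by (simp only: diff_le_mono2)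
qed (use assms in auto)

text \<open>The smallest matrix index belongs to the largest column, and the indices above
  \<open>t - q\<close> belong to the columns below \<open>q\<close>. The bound \<open>t\<close>
  keeps the truncated subtraction injective on \<open>K\<close>.\<close>

lemma pf_reflect:
  fixes f :: "nat \<Rightarrow> nat \<Rightarrow> 'a::comm_ring_1"
  assumes K: "finite K" "card K = 2 * Suc m" "K \<subseteq> {..t}"
  shows "pf (Suc m) f ((\<lambda>q. t - q) ` K) = (\<Sum>q\<in>K - {Max K}. (-1) ^ card {x \<in> K. x < q} *
     f (t - Max K) (t - q) * pf m f ((\<lambda>q. t - q) ` (K - {q, Max K})))"
proof -
  let ?r = "\<lambda>q. t - q"
  have ne: "K \<noteq> {}" using K by auto
  have inj: "inj_on ?r K"
    by (rule inj_onI) (metis K(3) atMost_iff diff_diff_cancel subsetD)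
  have min: "Min (?r ` K) = ?r (Max K)" by (rule Min_reflect[OF K(1) ne K(3)])
  have MK: "Max K \<in> K" using K ne by simp
  have "pf (Suc m) f (?r ` K) = (\<Sum>c\<in>?r ` (K - {Max K}). (-1) ^ card {x \<in> ?r ` K. c < x} *
     f (?r (Max K)) c * pf m f (?r ` K - {?r (Max K), c}))"
    by (subst pf_Suc_above)
      (use K ne MK in \<open>simp_all add: card_image inj min inj_on_image_set_diff[OF inj]\<close>)
  also have "\<dots> = (\<Sum>q\<in>K - {Max K}. (-1) ^ card {x \<in> ?r ` K. ?r q < x} *
     f (?r (Max K)) (?r q) * pf m f (?r ` K - {?r (Max K), ?r q}))"
    by (subst sum.reindex) (auto intro: inj_on_subset[OF inj])
  also have "\<dots> = (\<Sum>q\<in>K - {Max K}. (-1) ^ card {x \<in> K. x < q} *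
     f (t - Max K) (t - q) * pf m f (?r ` (K - {q, Max K})))"
  proof (rule sum.cong[OF refl])
    fix q assume q: "q \<in> K - {Max K}"
    have "{x \<in> ?r ` K. ?r q < x} = ?r ` {x \<in> K. x < q}" using q K(3) by auto
    then have "card {x \<in> ?r ` K. ?r q < x} = card {x \<in> K. x < q}"
      by (simp add: card_image inj_on_subset[OF inj])
    moreover have "?r ` K - {?r (Max K), ?r q} = ?r ` (K - {q, Max K})"
      using inj_on_image_set_diff[OF inj, of K "{q, Max K}"] q MK by (simp add: insert_commute)
    ultimately show "(-1) ^ card {x \<in> ?r ` K. ?r q < x} *
        f (?r (Max K)) (?r q) * pf m f (?r ` K - {?r (Max K), ?r q}) =
      (-1) ^ card {x \<in> K. x < q} * f (t - Max K) (t - q) * pf m f (?r ` (K - {q, Max K}))"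
      by simp
  qed
  finally show ?thesis .
qed

text \<open>The signs \<open>(-1) ^ (q' - q - 1)\<close> multiply to
  \<open>(-1) ^ (m + \<Sum>K)\<close> for every matching, because each exponent has the parity of
  \<open>q + q' + 1\<close>. The Pfaffian of the bare weights is then a single power of \<epsilon>
  by \<open>sum_weight\<close>.\<close>

lemma pf_weight:
  assumes "finite K" "card K = 2 * m" "K \<subseteq> {..t}"
    and f: "\<And>q q'. q < q' \<Longrightarrow> q \<in> K \<Longrightarrow> q' \<in> K \<Longrightarrow> f (t - q') (t - q) = (-1) ^ (q' - q - 1) * weight k b \<epsilon> q q'"
  shows "pf m f ((\<lambda>q. t - q) ` K) = (-1) ^ (m + \<Sum>K) * \<epsilon> ^ low_exponent k (card {x \<in> K. x < b})"
  using assms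
proof (induction m arbitrary: K)
  case 0
  then show ?case by (simp add: low_exponent_def)
next
  case (Suc m)
  note K = Suc.prems(1-3)
  let ?M = "Max K"
  have MK: "?M \<in> K" using K by (intro Max_in) auto
  have "pf (Suc m) f ((\<lambda>q. t - q) ` K) = (\<Sum>q\<in>K - {?M}. (-1) ^ card {x \<in> K. x < q} *
     f (t - ?M) (t - q) * pf m f ((\<lambda>q. t - q) ` (K - {q, ?M})))"
    by (rule pf_reflect[OF K])
  also have "\<dots> = (\<Sum>q\<in>K - {?M}. (-1) ^ (Suc m + \<Sum>K) * ((-1) ^ card {x \<in> K. x < q} *
     (weight k b \<epsilon> q ?M * \<epsilon> ^ low_exponent k (card {x \<in> K - {q, ?M}. x < b}))))"
  proof (rule sum.cong[OF refl])
    fix q assume q: "q \<in> K - {?M}"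
    have lt: "q < ?M" using q K(1) by (simp add: order.not_eq_order_implies_strict)
    have card: "card (K - {q, ?M}) = 2 * m"
      using K MK q by (subst card_Diff_subset) (auto simp: card_insert_if)
    have "\<Sum>K = \<Sum>(K - {q, ?M}) + \<Sum>{q, ?M}"
      using K MK q by (intro sum.subset_diff) auto
    then have sum: "\<Sum>K = \<Sum>(K - {q, ?M}) + (q + ?M)" using q by simp
    have "pf m f ((\<lambda>q. t - q) ` (K - {q, ?M})) =
       (-1) ^ (m + \<Sum>(K - {q, ?M})) * \<epsilon> ^ low_exponent k (card {x \<in> K - {q, ?M}. x < b})"
      by (rule Suc.IH[OF _ card]) (use K Suc.prems(4) in auto)
    moreover have "f (t - ?M) (t - q) = (-1) ^ (?M - q - 1) * weight k b \<epsilon> q ?M"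
      using Suc.prems(4) lt q MK by simp
    moreover have "(-1 :: real) ^ (?M - q - 1) * (-1) ^ (m + \<Sum>(K - {q, ?M})) = (-1) ^ (Suc m + \<Sum>K)"
    proof -
      have "even (?M - q - 1 + (m + \<Sum>(K - {q, ?M}))) \<longleftrightarrow> even (Suc m + \<Sum>K)"
        using lt unfolding sum by presburger
      then show ?thesis unfolding power_add[symmetric] unfolding minus_one_power_iff by (simp only:)
    qed
    moreover have "x * (y * w) * (z * e) = (y * z) * (x * (w * e))" for x y w z e :: real
      by (simp add: mult_ac)
    ultimately show "(-1) ^ card {x \<in> K. x < q} *
       f (t - ?M) (t - q) * pf m f ((\<lambda>q. t - q) ` (K - {q, ?M})) =
      (-1) ^ (Suc m + \<Sum>K) * ((-1) ^ card {x \<in> K. x < q} *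
       (weight k b \<epsilon> q ?M * \<epsilon> ^ low_exponent k (card {x \<in> K - {q, ?M}. x < b})))"
      by (simp only:)
  qed
  also have "\<dots> = (-1) ^ (Suc m + \<Sum>K) * \<epsilon> ^ low_exponent k (card {x \<in> K. x < b})"
    by (subst sum_distrib_left[symmetric], subst sum_weight[OF K(1,2) refl]) (rule refl)
  finally show ?case .
qed

section \<open>Expansion along the zero block\<close>

text \<open>The minor on the columns \<open>I\<close>, as its Laplace expansion along the first row,
  for \<open>card I\<close> equal to the number of rows.\<close>

primrec row_det :: "(nat \<Rightarrow> real) list \<Rightarrow> nat set \<Rightarrow> real" where
  "row_det [] I = 1"
| "row_det (r # rs) I =
    (\<Sum>q\<in>I. (-1) ^ card {x \<in> I. x < q} * r q * row_det rs (I - {q}))"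

text \<open>Inversions of the arrangement that lists \<open>I\<close> before \<open>K\<close>; their
  parity gives the Laplace sign of this splitting of the columns.\<close>

definition crossings :: "nat set \<Rightarrow> nat set \<Rightarrow> nat" where
  "crossings I K = (\<Sum>c\<in>I. card {x \<in> K. x < c})"

text \<open>Double counting of \<open>Suc d\<close>-subsets with a marked element. It regroups an
  expansion that first picks the column \<open>q\<close> by the whole set of columns used.\<close>

lemma sum_subsets_Suc:
  assumes "finite C"
  shows "(\<Sum>q\<in>C. \<Sum>I | I \<subseteq> C - {q} \<and> card I = d. G q I) =
    (\<Sum>I | I \<subseteq> C \<and> card I = Suc d. \<Sum>q\<in>I. G q (I - {q}))"
proof -
  have "(\<Sum>q\<in>C. \<Sum>I | I \<subseteq> C - {q} \<and> card I = d. G q I) =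
      (\<Sum>(q, I)\<in>(SIGMA q:C. {I. I \<subseteq> C - {q} \<and> card I = d}). G q I)"
    using assms by (intro sum.Sigma) auto
  also have "\<dots> = (\<Sum>(I, q)\<in>(SIGMA I:{I. I \<subseteq> C \<and> card I = Suc d}. I). G q (I - {q}))"
  proof (rule sum.reindex_bij_witness[where i = "\<lambda>(I, q). (q, I - {q})" and j = "\<lambda>(q, I). (insert q I, q)"])
    fix x assume "x \<in> (SIGMA q:C. {I. I \<subseteq> C - {q} \<and> card I = d})"
    then obtain q I where x: "x = (q, I)" "q \<in> C" "I \<subseteq> C - {q}" "card I = d" by blast
    then have "q \<notin> I" "finite I" using assms by (auto intro: finite_subset)
    with x show "(case case x of (q, I) \<Rightarrow> (insert q I, q) of (I, q) \<Rightarrow> (q, I - {q})) = x"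
      and "(case x of (q, I) \<Rightarrow> (insert q I, q)) \<in> (SIGMA I:{I. I \<subseteq> C \<and> card I = Suc d}. I)"
      and "(case case x of (q, I) \<Rightarrow> (insert q I, q) of (I, q) \<Rightarrow> G q (I - {q})) = (case x of (q, I) \<Rightarrow> G q I)"
      by auto
  next
    fix y assume "y \<in> (SIGMA I:{I. I \<subseteq> C \<and> card I = Suc d}. I)"
    then obtain I q where y: "y = (I, q)" "q \<in> I" "I \<subseteq> C" "card I = Suc d" by blast
    then have "finite I" using assms by (auto intro: finite_subset)
    with y show "(case case y of (I, q) \<Rightarrow> (q, I - {q}) of (q, I) \<Rightarrow> (insert q I, q)) = y"
      and "(case y of (I, q) \<Rightarrow> (q, I - {q})) \<in> (SIGMA q:C. {I. I \<subseteq> C - {q} \<and> card I = d})"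
      by auto
  qed
  also have "\<dots> = (\<Sum>I | I \<subseteq> C \<and> card I = Suc d. \<Sum>q\<in>I. G q (I - {q}))"
    using assms by (intro sum.Sigma[symmetric]) (auto intro: finite_subset)
  finally show ?thesis .
qed

text \<open>Induction on the number \<open>d\<close> of rows still unmatched. As the entries between
  two such rows vanish, the first row has to be matched with a column \<open>q\<close>. The columns
  below \<open>q\<close> split into those in \<open>I\<close>, giving the sign of the minor, and
  those outside, giving crossings.\<close>

lemma pf_expand_rows:
  fixes f :: "nat \<Rightarrow> nat \<Rightarrow> real"
  assumes zero: "\<And>i j. i < j \<Longrightarrow> j < n \<Longrightarrow> f i j = 0"
    and row: "\<And>i q. i < n \<Longrightarrow> q \<in> C \<Longrightarrow> f i (t - q) = r i q"
    and "finite C" "\<And>q. q \<in> C \<Longrightarrow> q \<le> t" "\<And>q. q \<in> C \<Longrightarrow> n \<le> t - q" "card C = d + 2 * m" "d \<le> n"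
  shows "pf (d + m) f ({n - d..<n} \<union> (\<lambda>q. t - q) ` C) =
    (\<Sum>I | I \<subseteq> C \<and> card I = d. (-1) ^ crossings I (C - I) *
       row_det (map r [n - d..<n]) I * pf m f ((\<lambda>q. t - q) ` (C - I)))"
  using assms(2-)
proof (induction d arbitrary: C)
  case 0
  then have "{I. I \<subseteq> C \<and> card I = 0} = {{}}" by (auto simp: finite_subset)
  then show ?case by (simp add: crossings_def)
next
  case (Suc d)
  note C = Suc.prems
  let ?\<rho> = "\<lambda>q. t - q"
  define i where "i = n - Suc d"
  have i: "i < n" "Suc i = n - d" using C(6) by (auto simp: i_def)
  define S where "S = {i..<n} \<union> ?\<rho> ` C"
  have inj: "inj_on ?\<rho> C" by (rule inj_onI) (metis C(3) diff_diff_cancel)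
  have disj: "{i..<n} \<inter> ?\<rho> ` C = {}" using C(4) by fastforce
  have fin: "finite S" using C(2) by (simp add: S_def)
  have cardS: "card S = 2 * Suc (d + m)"
    unfolding S_def using disj C inj i by (subst card_Un_disjoint) (auto simp: card_image i_def)
  have minS: "Min S = i"
    by (rule Min_eqI[OF fin]) (use i C(4) in \<open>fastforce simp: S_def\<close>)+
  have step: "(-1) ^ card {x \<in> S. ?\<rho> q < x} * f i (?\<rho> q) * pf (d + m) f (S - {i, ?\<rho> q}) =
      (\<Sum>I | I \<subseteq> C - {q} \<and> card I = d. (-1) ^ card {x \<in> C. x < q} * r i q *
        ((-1) ^ crossings I (C - {q} - I) * row_det (map r [n - d..<n]) I * pf m f (?\<rho> ` (C - {q} - I))))"
    if q: "q \<in> C" for q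
  proof -
    \<comment> \<open>Row indices are below \<open>n\<close> and column indices are not, so only
      columns lie above \<open>t - q\<close>, and the reflection makes them those below
      \<open>q\<close>.\<close>
    have "{x \<in> S. ?\<rho> q < x} = ?\<rho> ` {x \<in> C. x < q}"
      using C(3,4) q by (fastforce simp: S_def)
    then have "card {x \<in> S. ?\<rho> q < x} = card {x \<in> C. x < q}"
      by (simp add: card_image inj_on_subset[OF inj])
    moreover have "S - {i, ?\<rho> q} = {n - d..<n} \<union> ?\<rho> ` (C - {q})"
    proof -
      have "?\<rho> ` (C - {q}) = ?\<rho> ` C - {?\<rho> q}"
        using inj_on_image_set_diff[OF inj, of C "{q}"] q by simp
      moreover have "{i..<n} - {i} = {n - d..<n}" using i by auto
      ultimately show ?thesis using disj q i unfolding S_def by auto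
    qed
    moreover have "pf (d + m) f ({n - d..<n} \<union> ?\<rho> ` (C - {q})) =
      (\<Sum>I | I \<subseteq> C - {q} \<and> card I = d. (-1) ^ crossings I (C - {q} - I) *
         row_det (map r [n - d..<n]) I * pf m f (?\<rho> ` (C - {q} - I)))"
      by (rule Suc.IH) (use C q in auto)
    ultimately show ?thesis using C(1)[OF i(1) q] by (simp only: sum_distrib_left)
  qed
  have "pf (Suc d + m) f ({n - Suc d..<n} \<union> ?\<rho> ` C) = pf (Suc (d + m)) f S"
    by (simp add: S_def i_def del: pf.simps)
  also have "\<dots> = (\<Sum>c\<in>S - {i}. (-1) ^ card {x \<in> S. c < x} * f i c * pf (d + m) f (S - {i, c}))"
    using pf_Suc_above[OF fin cardS, of f] by (simp only: minS)
  \<comment> \<open>Matching row \<open>i\<close> with another row contributes 0 by the zero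
    block.\<close>
  also have "\<dots> = (\<Sum>c\<in>?\<rho> ` C. (-1) ^ card {x \<in> S. c < x} * f i c * pf (d + m) f (S - {i, c}))"
  proof (rule sum.mono_neutral_right)
    show "?\<rho> ` C \<subseteq> S - {i}" using disj i by (auto simp: S_def)
    show "\<forall>c\<in>S - {i} - ?\<rho> ` C. (-1) ^ card {x \<in> S. c < x} * f i c * pf (d + m) f (S - {i, c}) = 0"
      using zero[of i] by (auto simp: S_def)
  qed (use fin in simp)
  also have "\<dots> = (\<Sum>q\<in>C. (-1) ^ card {x \<in> S. ?\<rho> q < x} * f i (?\<rho> q) * pf (d + m) f (S - {i, ?\<rho> q}))"
    by (subst sum.reindex[OF inj]) simp
  also have "\<dots> = (\<Sum>q\<in>C. \<Sum>I | I \<subseteq> C - {q} \<and> card I = d. (-1) ^ card {x \<in> C. x < q} * r i q *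
        ((-1) ^ crossings I (C - {q} - I) * row_det (map r [n - d..<n]) I * pf m f (?\<rho> ` (C - {q} - I))))"
    by (rule sum.cong[OF refl step])
  also have "\<dots> = (\<Sum>I | I \<subseteq> C \<and> card I = Suc d. \<Sum>q\<in>I. (-1) ^ card {x \<in> C. x < q} * r i q *
        ((-1) ^ crossings (I - {q}) (C - {q} - (I - {q})) * row_det (map r [n - d..<n]) (I - {q}) *
          pf m f (?\<rho> ` (C - {q} - (I - {q})))))"
    by (rule sum_subsets_Suc[OF C(2)])
  also have "\<dots> = (\<Sum>I | I \<subseteq> C \<and> card I = Suc d. (-1) ^ crossings I (C - I) *
       row_det (map r [n - Suc d..<n]) I * pf m f (?\<rho> ` (C - I)))"
  proof (rule sum.cong[OF refl])
    fix I assume "I \<in> {I. I \<subseteq> C \<and> card I = Suc d}"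
    then have I: "I \<subseteq> C" "finite I" using C(2) by (auto intro: finite_subset)
    have "(-1) ^ card {x \<in> C. x < q} * r i q *
        ((-1) ^ crossings (I - {q}) (C - {q} - (I - {q})) * row_det (map r [n - d..<n]) (I - {q}) *
          pf m f (?\<rho> ` (C - {q} - (I - {q})))) =
        (-1) ^ crossings I (C - I) * ((-1) ^ card {x \<in> I. x < q} * r i q *
          row_det (map r [n - d..<n]) (I - {q})) * pf m f (?\<rho> ` (C - I))" if q: "q \<in> I" for q
    proof -
      have D: "C - {q} - (I - {q}) = C - I" using q by auto
      have "{x \<in> C. x < q} = {x \<in> I. x < q} \<union> {x \<in> C - I. x < q}" using I by auto
      moreover have "card ({x \<in> I. x < q} \<union> {x \<in> C - I. x < q}) =
          card {x \<in> I. x < q} + card {x \<in> C - I. x < q}"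
        by (rule card_Un_disjoint) (use I C(2) in auto)
      ultimately have card: "card {x \<in> C. x < q} = card {x \<in> I. x < q} + card {x \<in> C - I. x < q}"
        by simp
      have cross: "crossings I (C - I) = card {x \<in> C - I. x < q} + crossings (I - {q}) (C - I)"
        unfolding crossings_def by (rule sum.remove[OF I(2) q])
      show ?thesis unfolding D card cross power_add by (simp add: mult_ac)
    qed
    moreover have "map r [n - Suc d..<n] = r i # map r [n - d..<n]"
      using i by (simp add: i_def upt_conv_Cons)
    ultimately show "(\<Sum>q\<in>I. (-1) ^ card {x \<in> C. x < q} * r i q *
        ((-1) ^ crossings (I - {q}) (C - {q} - (I - {q})) * row_det (map r [n - d..<n]) (I - {q}) *
          pf m f (?\<rho> ` (C - {q} - (I - {q}))))) = (-1) ^ crossings I (C - I) *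
       row_det (map r [n - Suc d..<n]) I * pf m f (?\<rho> ` (C - I))"
      by (simp only: row_det.simps sum_distrib_left sum_distrib_right cong: sum.cong)
  qed
  finally show ?case .
qed

text \<open>Adding a top point \<open>M\<close> outside \<open>K\<close> creates
  \<open>card K\<close> crossings, adding one inside creates none. The equation is doubled and kept
  free of subtraction so that it is linear over the naturals in each step.\<close>

lemma crossings_complement:
  assumes "K \<subseteq> {..<M}"
  shows "2 * crossings ({..<M} - K) K + 2 * \<Sum>K + card K * (card K + 1) = 2 * card K * M"
  using assms
proof (induction M arbitrary: K)
  case 0
  then show ?case by (simp add: crossings_def)
next
  case (Suc M)
  have fin: "finite K" using Suc.prems by (rule finite_subset) simp
  show ?case
  proof (cases "M \<in> K")
    case False
    then have K: "K \<subseteq> {..<M}" using Suc.prems by (auto simp: less_Suc_eq)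
    then have "{x \<in> K. x < M} = K" by auto
    moreover have "{..<Suc M} - K = insert M ({..<M} - K)" using False by auto
    ultimately have "crossings ({..<Suc M} - K) K = card K + crossings ({..<M} - K) K"
      by (simp add: crossings_def)
    then show ?thesis using Suc.IH[OF K] by (simp add: algebra_simps)
  next
    case True
    define L where "L = K - {M}"
    have L: "L \<subseteq> {..<M}" using Suc.prems by (auto simp: L_def less_Suc_eq)
    have KL: "K = insert M L" "M \<notin> L" "finite L" using True fin by (auto simp: L_def)
    have "{x \<in> K. x < c} = {x \<in> L. x < c}" if "c < M" for c using that KL by auto
    moreover have "{..<Suc M} - K = {..<M} - L" using KL by auto
    ultimately have "crossings ({..<Suc M} - K) K = crossings ({..<M} - L) L"
      by (simp add: crossings_def)
    then show ?thesis using Suc.IH[OF L] KL by (simp add: algebra_simps)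
  qed
qed

text \<open>The Laplace sign and the sign from \<open>pf_weight\<close> cancel, since the complement
  of \<open>I\<close> has even size \<open>2 * m\<close>.\<close>

theorem pf_eq_sum_row_det:
  fixes f :: "nat \<Rightarrow> nat \<Rightarrow> real"
  assumes zero: "\<And>i j. i < j \<Longrightarrow> j < n \<Longrightarrow> f i j = 0"
    and row: "\<And>i q. i < n \<Longrightarrow> q < n + 2 * m \<Longrightarrow> f i (2 * (n + m) - 1 - q) = r i q"
    and block: "\<And>q q'. q < q' \<Longrightarrow> q' < n + 2 * m \<Longrightarrow>
      f (2 * (n + m) - 1 - q') (2 * (n + m) - 1 - q) = (-1) ^ (q' - q - 1) * weight k b \<epsilon> q q'"
  shows "pf (n + m) f {0..<2 * (n + m)} =
    (\<Sum>I | I \<subseteq> {..<n + 2 * m} \<and> card I = n. row_det (map r [0..<n]) I *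
       \<epsilon> ^ low_exponent k (card {x \<in> {..<n + 2 * m} - I. x < b}))"
proof -
  let ?t = "2 * (n + m) - 1"
  let ?M = "n + 2 * m"
  have "{n..<2 * (n + m)} = (\<lambda>q. ?t - q) ` {..<?M}"
  proof (intro equalityI subsetI)
    fix x assume "x \<in> {n..<2 * (n + m)}"
    then have "x = ?t - (?t - x)" "?t - x < ?M" by auto
    then show "x \<in> (\<lambda>q. ?t - q) ` {..<?M}" by blast
  qed auto
  moreover have "{0..<2 * (n + m)} = {n - n..<n} \<union> {n..<2 * (n + m)}" by auto
  ultimately have "pf (n + m) f {0..<2 * (n + m)} =
      pf (n + m) f ({n - n..<n} \<union> (\<lambda>q. ?t - q) ` {..<?M})"
    by (simp only:)
  also have "\<dots> = (\<Sum>I | I \<subseteq> {..<?M} \<and> card I = n. (-1) ^ crossings I ({..<?M} - I) *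
       row_det (map r [n - n..<n]) I * pf m f ((\<lambda>q. ?t - q) ` ({..<?M} - I)))"
    by (rule pf_expand_rows) (use zero row in auto)
  also have "\<dots> = (\<Sum>I | I \<subseteq> {..<?M} \<and> card I = n. row_det (map r [0..<n]) I *
       \<epsilon> ^ low_exponent k (card {x \<in> {..<?M} - I. x < b}))"
  proof (rule sum.cong[OF refl])
    fix I assume "I \<in> {I. I \<subseteq> {..<?M} \<and> card I = n}"
    then have I: "I \<subseteq> {..<?M}" "card I = n" "finite I" by (auto intro: finite_subset)
    define K where "K = {..<?M} - I"
    have K: "finite K" "card K = 2 * m" "K \<subseteq> {..<?M}" "{..<?M} - K = I"
      using I by (auto simp: K_def card_Diff_subset)
    have "pf m f ((\<lambda>q. ?t - q) ` K) =
        (-1) ^ (m + \<Sum>K) * \<epsilon> ^ low_exponent k (card {x \<in> K. x < b})"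
      by (rule pf_weight[OF K(1,2)]) (use K(3) block in auto)
    moreover have "(-1 :: real) ^ crossings I K * (-1) ^ (m + \<Sum>K) = 1"
    proof -
      have "2 * (crossings I K + \<Sum>K + m * (2 * m + 1)) = 2 * (2 * m * ?M)"
        using crossings_complement[OF K(3)] unfolding K(2,4) by (simp add: algebra_simps)
      then have "crossings I K + \<Sum>K + m * (2 * m + 1) = 2 * (m * ?M)" by simp
      then have "even (crossings I K + \<Sum>K + m * (2 * m + 1))" by simp
      \<comment> \<open>\<open>m * (2 * m + 1)\<close> has the parity of \<open>m\<close>.\<close>
      then have "even (crossings I K + (m + \<Sum>K))" by auto
      then show ?thesis by (simp add: power_add[symmetric])
    qed
    ultimately show "(-1) ^ crossings I ({..<?M} - I) * row_det (map r [n - n..<n]) I *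
        pf m f ((\<lambda>q. ?t - q) ` ({..<?M} - I)) =
      row_det (map r [0..<n]) I * \<epsilon> ^ low_exponent k (card {x \<in> {..<?M} - I. x < b})"
      unfolding K_def[symmetric] by (simp add: mult_ac)
  qed
  finally show ?thesis .
qed

section \<open>The limit\<close>

text \<open>Row \<open>i\<close> of \<open>B\<close> without a bound on the column, and hence
  independent of \<open>N\<close>.\<close>

definition binom_row :: "nat \<Rightarrow> nat \<Rightarrow> real" where
  "binom_row i q = (if i \<le> q then real (i choose (q - i)) else 0)"

section \<open>Entries of the block matrix\<close>

lemma dim_J_mat [simp]: "dim_row (J_mat M) = M" "dim_col (J_mat M) = M"
  by (simp_all add: J_mat_def)

lemma mult_J_mat:
  assumes "i < dim_row A" "j < M" "dim_col A = M"
  shows "(A * J_mat M) $$ (i, j) = A $$ (i, M - 1 - j)"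
proof -
  have "(A * J_mat M) $$ (i, j) = (\<Sum>l\<in>{0..<M}. A $$ (i, l) * (if l + j + 1 = M then 1 else 0))"
    using assms by (simp add: scalar_prod_def J_mat_def)
  also have "\<dots> = (\<Sum>l\<in>{0..<M}. if l = M - 1 - j then A $$ (i, l) else 0)"
    using assms by (intro sum.cong) auto
  also have "\<dots> = A $$ (i, M - 1 - j)" using assms by simp
  finally show ?thesis .
qed

lemma J_mat_mult:
  assumes "i < M" "j < dim_col A" "dim_row A = M"
  shows "(J_mat M * A) $$ (i, j) = A $$ (M - 1 - i, j)"
proof -
  have "(J_mat M * A) $$ (i, j) = (\<Sum>l\<in>{0..<M}. (if i + l + 1 = M then 1 else 0) * A $$ (l, j))"
    using assms by (simp add: scalar_prod_def J_mat_def)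
  also have "\<dots> = (\<Sum>l\<in>{0..<M}. if l = M - 1 - i then A $$ (l, j) else 0)"
    using assms by (intro sum.cong) auto
  also have "\<dots> = A $$ (M - 1 - i, j)" using assms by simp
  finally show ?thesis .
qed

text \<open>The reflection in \<open>pf_eq_sum_row_det\<close> undoes the reversals: index
  \<open>2 * (n + m) - 1 - q\<close> carries column \<open>q\<close> of \<open>B\<close> in the
  upper right block, and the lower right block becomes \<open>L_bar\<close> read at columns
  \<open>q < q'\<close>.\<close>

lemma pfaffian_block_matrix:
  assumes N: "N = 2 * m"
  shows "pfaffian (four_block_mat (0\<^sub>m n n) (B_mat n N * J_mat (n + N))
      (- J_mat (n + N) * transpose_mat (B_mat n N))
      (J_mat (n + N) * transpose_mat (L_bar (n + N) n k \<epsilon>) * J_mat (n + N))) =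
    (\<Sum>I | I \<subseteq> {..<n + N} \<and> card I = n. row_det (map binom_row [0..<n]) I *
       \<epsilon> ^ low_exponent k (card {x \<in> {..<n + N} - I. x < n + k}))" (is "pfaffian ?A = _")
proof -
  let ?M = "n + N"
  let ?D = "J_mat ?M * transpose_mat (L_bar ?M n k \<epsilon>) * J_mat ?M"
  have dims: "dim_row (L_bar ?M n k \<epsilon>) = ?M" "dim_col (L_bar ?M n k \<epsilon>) = ?M"
    "dim_row (B_mat n N) = n" "dim_col (B_mat n N) = ?M"
    by (simp_all add: L_bar_def B_mat_def)
  have BJ: "(B_mat n N * J_mat ?M) $$ (i, j) = binom_row i (?M - 1 - j)" if "i < n" "j < ?M" for i j
    using that by (subst mult_J_mat) (auto simp: dims B_mat_def binom_row_def)
  \<comment> \<open>Transposing and reversing both orders maps the part above the diagonal to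
    itself, so the formula for the upper entries applies with its sign.\<close>
  have D: "?D $$ (i, j) = (-1) ^ (?M - 1 - i - (?M - 1 - j) - 1) * weight k (n + k) \<epsilon> (?M - 1 - j) (?M - 1 - i)"
    if "i < j" "j < ?M" for i j
  proof -
    have "?D $$ (i, j) = (J_mat ?M * transpose_mat (L_bar ?M n k \<epsilon>)) $$ (i, ?M - 1 - j)"
      using that by (subst mult_J_mat) (auto simp: dims)
    also have "\<dots> = transpose_mat (L_bar ?M n k \<epsilon>) $$ (?M - 1 - i, ?M - 1 - j)"
      using that by (subst J_mat_mult) (auto simp: dims)
    also have "\<dots> = L_bar ?M n k \<epsilon> $$ (?M - 1 - j, ?M - 1 - i)"
      using that by (subst index_transpose_mat(1)) (auto simp: dims)
    also have "\<dots> = L_bar_upper n k \<epsilon> (?M - 1 - j + 1) (?M - 1 - i + 1)"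
      using that by (simp add: L_bar_def)
    \<comment> \<open>\<open>L_bar_upper\<close> compares 1-based indices with \<open>n + k\<close>
      by \<open>\<le>\<close>, \<open>weight\<close> compares 0-based ones by
      \<open><\<close>.\<close>
    finally show ?thesis using that by (auto simp: L_bar_upper_def weight_def)
  qed
  have dimA: "dim_row ?A = 2 * (n + m)" by (simp add: dims N)
  have A: "?A $$ (i, j) = (if i < n then if j < n then 0 else binom_row i (?M - 1 - (j - n))
      else ?D $$ (i - n, j - n))" if "i < j" "j < n + ?M" for i j
    using that by (subst index_mat_four_block) (auto simp: dims BJ simp del: index_mult_mat(1))
  have "pfaffian ?A = pf (n + m) (\<lambda>i j. ?A $$ (i, j)) {0..<2 * (n + m)}"
    by (rule pfaffian_eq_pf[OF dimA])
  also have "\<dots> = (\<Sum>I | I \<subseteq> {..<n + 2 * m} \<and> card I = n. row_det (map binom_row [0..<n]) I *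
       \<epsilon> ^ low_exponent k (card {x \<in> {..<n + 2 * m} - I. x < n + k}))"
  proof (rule pf_eq_sum_row_det)
    fix i j assume "i < j" "j < n"
    then show "?A $$ (i, j) = 0" by (subst A) simp_all
  next
    fix i q assume iq: "i < n" "q < n + 2 * m"
    define p where "p = ?M - 1 - q"
    have "2 * (n + m) - 1 - q = n + p" "?M - 1 - p = q" "p < ?M"
      using iq(2) N by (simp_all add: p_def)
    then show "?A $$ (i, 2 * (n + m) - 1 - q) = binom_row i q"
      using A[of i "n + p"] BJ[of i p] iq(1)
      by (simp del: index_mat_four_block(1) index_mult_mat(1))
  next
    fix q q' assume q: "q < q'" "q' < n + 2 * m"
    define p p' where "p = ?M - 1 - q" and "p' = ?M - 1 - q'"
    have "2 * (n + m) - 1 - q = n + p" "2 * (n + m) - 1 - q' = n + p'"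
      "?M - 1 - p = q" "?M - 1 - p' = q'" "p' < p" "p < ?M"
      using q N by (simp_all add: p_def p'_def)
    then show "?A $$ (2 * (n + m) - 1 - q', 2 * (n + m) - 1 - q) =
        (-1) ^ (q' - q - 1) * weight k (n + k) \<epsilon> q q'"
      using A[of "n + p'" "n + p"] D[of p' p]
      by (simp del: index_mat_four_block(1) index_mult_mat(1))
  qed
  finally show ?thesis by (simp only: N)
qed

text \<open>If \<open>d\<close> elements of \<open>I\<close> lie outside the first
  \<open>n + k\<close> columns, then \<open>k + d\<close> of these columns stay free. The two parity
  cases of the weights are made so that already \<open>d = 1\<close> raises the exponent:
  \<open>k + 1\<close> is rounded up for even \<open>k\<close>, down for odd
  \<open>k\<close>.\<close>

lemma low_exponent_complement:
  assumes "I \<subseteq> {..<n + N}" "card I = n" "k \<le> N"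
  shows "k div 2 \<le> low_exponent k (card {x \<in> {..<n + N} - I. x < n + k})"
    and "low_exponent k (card {x \<in> {..<n + N} - I. x < n + k}) = k div 2 \<longleftrightarrow> I \<subseteq> {..<n + k}"
proof -
  let ?a = "card {x \<in> {..<n + N} - I. x < n + k}"
  have fin: "finite I" using assms(1) by (rule finite_subset) simp
  have "{x \<in> {..<n + N} - I. x < n + k} = {..<n + k} - (I \<inter> {..<n + k})" using assms by auto
  then have a: "?a = n + k - card (I \<inter> {..<n + k})"
    using fin by (simp add: card_Diff_subset)
  have le: "card (I \<inter> {..<n + k}) \<le> n"
    using fin card_mono[of I "I \<inter> {..<n + k}"] assms(2) by simp
  have eq: "card (I \<inter> {..<n + k}) = n \<longleftrightarrow> I \<subseteq> {..<n + k}"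
    using fin card_subset_eq[of I "I \<inter> {..<n + k}"] assms(2) by (auto simp: Int_absorb2)
  obtain d where d: "n = card (I \<inter> {..<n + k}) + d" using le le_Suc_ex by blast
  then have a: "?a = d + k" unfolding a by linarith
  have "card (I \<inter> {..<n + k}) = n \<longleftrightarrow> d = 0" using d by linarith
  then have sub: "I \<subseteq> {..<n + k} \<longleftrightarrow> d = 0" using eq by simp
  show "k div 2 \<le> low_exponent k ?a"
    unfolding a low_exponent_def by (simp add: div_le_mono)
  have "low_exponent k (d + k) = k div 2 \<longleftrightarrow> d = 0"
    unfolding low_exponent_def by presburger
  then show "low_exponent k ?a = k div 2 \<longleftrightarrow> I \<subseteq> {..<n + k}"
    unfolding a sub .
qed

text \<open>Divided by \<open>\<epsilon> ^ (k div 2)\<close>, the expansion is a polynomial in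
  \<epsilon>, and its value at 0 keeps the minors of minimal exponent.\<close>

theorem pfaffian_limit:
  assumes "even N" "k \<le> N"
  shows "((\<lambda>\<epsilon>::real. \<epsilon> powi (- \<lfloor>real k / 2\<rfloor>) *
            pfaffian (four_block_mat (0\<^sub>m n n) (B_mat n N * J_mat (n + N))
              (- J_mat (n + N) * transpose_mat (B_mat n N))
              (J_mat (n + N) * transpose_mat (L_bar (n + N) n k \<epsilon>) * J_mat (n + N))))
          \<longlongrightarrow> (\<Sum>I | I \<subseteq> {..<n + k} \<and> card I = n. row_det (map binom_row [0..<n]) I)) (at 0)"
    (is "(?F \<longlongrightarrow> ?l) _")
proof -
  obtain m where N: "N = 2 * m" using assms(1) by (rule evenE)
  let ?e = "\<lambda>I. low_exponent k (card {x \<in> {..<n + N} - I. x < n + k})"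
  let ?X = "{I. I \<subseteq> {..<n + N} \<and> card I = n}"
  let ?G = "\<lambda>\<epsilon>::real. \<Sum>I\<in>?X. row_det (map binom_row [0..<n]) I * \<epsilon> ^ (?e I - k div 2)"
  have "\<lfloor>real k / 2\<rfloor> = int (k div 2)" by linarith
  then have F: "?F \<epsilon> = ?G \<epsilon>" if "\<epsilon> \<noteq> 0" for \<epsilon>
    unfolding pfaffian_block_matrix[OF N] sum_distrib_left
  proof (intro sum.cong refl)
    fix I assume "I \<in> ?X"
    then have "k div 2 \<le> ?e I" using low_exponent_complement(1) assms(2) by simp
    then have "\<epsilon> ^ ?e I = \<epsilon> ^ (k div 2) * \<epsilon> ^ (?e I - k div 2)"
      by (simp add: power_add[symmetric])
    then show "\<epsilon> powi (- \<lfloor>real k / 2\<rfloor>) * (row_det (map binom_row [0..<n]) I * \<epsilon> ^ ?e I) =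
        row_det (map binom_row [0..<n]) I * \<epsilon> ^ (?e I - k div 2)"
      using \<open>\<lfloor>real k / 2\<rfloor> = int (k div 2)\<close> that by (simp add: power_int_minus)
  qed
  have "(?G \<longlongrightarrow> (\<Sum>I\<in>?X. row_det (map binom_row [0..<n]) I * 0 ^ (?e I - k div 2))) (at 0)"
    by (intro tendsto_intros)
  \<comment> \<open>As \<open>0 ^ 0 = 1\<close>, the power of 0 is the indicator of the minimal
    exponent.\<close>
  moreover have "(\<Sum>I\<in>?X. row_det (map binom_row [0..<n]) I * 0 ^ (?e I - k div 2)) = ?l"
  proof (rule sum.mono_neutral_cong_right)
    show "finite ?X" by simp
    show "{I. I \<subseteq> {..<n + k} \<and> card I = n} \<subseteq> ?X" using assms(2) by auto
    show "\<forall>I\<in>?X - {I. I \<subseteq> {..<n + k} \<and> card I = n}.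
        row_det (map binom_row [0..<n]) I * 0 ^ (?e I - k div 2) = 0"
    proof
      fix I assume I: "I \<in> ?X - {I. I \<subseteq> {..<n + k} \<and> card I = n}"
      then have "I \<subseteq> {..<n + N}" "card I = n" "\<not> I \<subseteq> {..<n + k}" by auto
      then have "k div 2 < ?e I"
        using low_exponent_complement[OF _ _ assms(2), of I n] by (metis le_neq_implies_less)
      then show "row_det (map binom_row [0..<n]) I * 0 ^ (?e I - k div 2) = 0" by simp
    qed
    fix I assume "I \<in> {I. I \<subseteq> {..<n + k} \<and> card I = n}"
    then have "I \<subseteq> {..<n + N}" "card I = n" "I \<subseteq> {..<n + k}" using assms(2) by auto
    then have "?e I = k div 2" using low_exponent_complement(2)[OF _ _ assms(2), of I n] by blast
    then show "row_det (map binom_row [0..<n]) I * 0 ^ (?e I - k div 2) =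
        row_det (map binom_row [0..<n]) I" by simp
  qed
  ultimately have "(?G \<longlongrightarrow> ?l) (at 0)" by simp
  \<comment> \<open>The two functions are compared away from 0 only, which is all that
    \<open>at 0\<close> sees.\<close>
  moreover have "\<forall>\<^sub>F \<epsilon> in at 0. ?G \<epsilon> = ?F \<epsilon>"
    using F by (simp add: eventually_at_filter)
  ultimately show ?thesis by (rule tendsto_cong[THEN iffD1, rotated])
qed

section \<open>Determinants indexed by partitions\<close>

text \<open>A determinant whose columns are positions \<open>v\<close> with labels
  \<open>\<phi> v\<close>. Unlike column sets, labels may repeat, as happens in multilinear
  expansions. Positions are read from the largest down, since partitions list their largest part
  first.\<close>

primrec col_det :: "(nat \<Rightarrow> real) list \<Rightarrow> nat set \<Rightarrow> (nat \<Rightarrow> nat) \<Rightarrow> real" where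
  "col_det [] V \<phi> = 1"
| "col_det (r # rs) V \<phi> =
    (\<Sum>v\<in>V. (-1) ^ card {w \<in> V. v < w} * r (\<phi> v) * col_det rs (V - {v}) \<phi>)"

lemma col_det_cong:
  assumes "\<And>v. v \<in> V \<Longrightarrow> \<phi> v = \<psi> v"
  shows "col_det rs V \<phi> = col_det rs V \<psi>"
  using assms
proof (induction rs arbitrary: V)
  case (Cons r rs)
  have "col_det rs (V - {v}) \<phi> = col_det rs (V - {v}) \<psi>" for v
    by (rule Cons.IH) (use Cons.prems in auto)
  then show ?case using Cons.prems by simp
qed simp

text \<open>A decreasing labelling turns the positions above \<open>v\<close> into the columns below
  \<open>\<phi> v\<close>, so the signs agree.\<close>

lemma row_det_image:
  assumes "\<And>v w. v \<in> V \<Longrightarrow> w \<in> V \<Longrightarrow> v < w \<Longrightarrow> \<phi> w < (\<phi> v :: nat)"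
  shows "row_det rs (\<phi> ` V) = col_det rs V \<phi>"
  using assms
proof (induction rs arbitrary: V)
  case (Cons r rs)
  have inj: "inj_on \<phi> V" by (rule inj_onI) (metis Cons.prems less_irrefl linorder_neqE_nat)
  have "(-1) ^ card {x \<in> \<phi> ` V. x < \<phi> v} * r (\<phi> v) * row_det rs (\<phi> ` V - {\<phi> v}) =
      (-1) ^ card {w \<in> V. v < w} * r (\<phi> v) * col_det rs (V - {v}) \<phi>" if v: "v \<in> V" for v
  proof -
    have "\<phi> w < \<phi> v \<longleftrightarrow> v < w" if "w \<in> V" for w
      using that v Cons.prems by (metis less_asym less_irrefl linorder_neqE_nat)
    then have "{x \<in> \<phi> ` V. x < \<phi> v} = \<phi> ` {w \<in> V. v < w}" by auto
    then have "card {x \<in> \<phi> ` V. x < \<phi> v} = card {w \<in> V. v < w}"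
      by (simp add: card_image inj_on_subset[OF inj])
    moreover have "\<phi> ` V - {\<phi> v} = \<phi> ` (V - {v})"
      using inj_on_image_set_diff[OF inj, of V "{v}"] v by simp
    moreover have "row_det rs (\<phi> ` (V - {v})) = col_det rs (V - {v}) \<phi>"
      by (rule Cons.IH) (use Cons.prems in auto)
    ultimately show ?thesis by simp
  qed
  then show ?case
    unfolding row_det.simps col_det.simps sum.reindex[OF inj] o_def by (intro sum.cong refl)
qed simp

section \<open>Rules for determinants with labelled columns\<close>

lemma col_det_reindex:
  assumes "strict_mono_on V h"
  shows "col_det rs (h ` V) \<phi> = col_det rs V (\<lambda>v. \<phi> (h v))"
  using assms
proof (induction rs arbitrary: V)
  case (Cons r rs)
  have inj: "inj_on h V" using Cons.prems by (rule strict_mono_on_imp_inj_on)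
  have "(-1) ^ card {w \<in> h ` V. h v < w} * r (\<phi> (h v)) * col_det rs (h ` V - {h v}) \<phi> =
      (-1) ^ card {w \<in> V. v < w} * r (\<phi> (h v)) * col_det rs (V - {v}) (\<lambda>v. \<phi> (h v))" if v: "v \<in> V" for v
  proof -
    have "{w \<in> h ` V. h v < w} = h ` {w \<in> V. v < w}"
      using v strict_mono_on_less[OF Cons.prems] by auto
    then have "card {w \<in> h ` V. h v < w} = card {w \<in> V. v < w}"
      by (simp add: card_image inj_on_subset[OF inj])
    moreover have "h ` V - {h v} = h ` (V - {v})"
      using inj_on_image_set_diff[OF inj, of V "{v}"] v by simp
    moreover have "col_det rs (h ` (V - {v})) \<phi> = col_det rs (V - {v}) (\<lambda>v. \<phi> (h v))"
      by (rule Cons.IH) (use Cons.prems in \<open>auto simp: strict_mono_on_def\<close>)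
    ultimately show ?thesis by simp
  qed
  then show ?case
    unfolding col_det.simps sum.reindex[OF inj] o_def by (intro sum.cong refl)
qed simp

lemma col_det_zero_column:
  assumes "finite V" "card V = length rs" "v \<in> V" "\<And>r. r \<in> set rs \<Longrightarrow> r (\<phi> v) = 0"
  shows "col_det rs V \<phi> = 0"
  using assms
proof (induction rs arbitrary: V)
  case (Cons r rs)
  have "r (\<phi> u) * col_det rs (V - {u}) \<phi> = 0" if u: "u \<in> V" for u
  proof (cases "u = v")
    case False
    have "col_det rs (V - {u}) \<phi> = 0"
      by (rule Cons.IH) (use Cons.prems False u in auto)
    then show ?thesis by simp
  qed (use Cons.prems in simp)
  then show ?case by (auto intro!: sum.neutral)
qed auto

text \<open>Terms that remove neither of the two neighbours vanish by induction. The two others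
  cancel: the ranks of neighbours differ by one, and the remaining minors coincide.\<close>

lemma col_det_repeated_column:
  assumes "finite V" "card V = length rs" "v \<in> V" "w \<in> V" "v < w" "\<phi> v = \<phi> w"
    and "\<And>u. u \<in> V \<Longrightarrow> u \<le> v \<or> w \<le> u"
  shows "col_det rs V \<phi> = 0"
  using assms
proof (induction rs arbitrary: V)
  case (Cons r rs)
  note V = Cons.prems
  let ?t = "\<lambda>u. (-1) ^ card {x \<in> V. u < x} * r (\<phi> u) * col_det rs (V - {u}) \<phi>"
  have "col_det rs (V - {u}) \<phi> = 0" if "u \<in> V - {v, w}" for u
    by (rule Cons.IH) (use V that in auto)
  then have "sum ?t (V - {v, w}) = 0" by (intro sum.neutral) auto
  moreover have "sum ?t V = sum ?t (V - {v, w}) + sum ?t {v, w}"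
    using V by (intro sum.subset_diff) auto
  ultimately have "sum ?t V = ?t v + ?t w" using V(5) by simp
  moreover have "?t v = - ?t w"
  proof -
    have "{x \<in> V. v < x} = insert w {x \<in> V. w < x}" using V(4,5,7) by force
    then have "card {x \<in> V. v < x} = Suc (card {x \<in> V. w < x})" using V(1) by simp
    moreover have "col_det rs (V - {v}) \<phi> = col_det rs (V - {w}) \<phi>"
    proof -
      \<comment> \<open>Moving \<open>v\<close> to \<open>w\<close> is monotone on
        \<open>V - {w}\<close> because nothing lies between them, and it leaves the labels
        unchanged.\<close>
      define h where "h = (\<lambda>x. if x = v then w else x)"
      have "strict_mono_on (V - {w}) h"
        using V(5,7) by (auto simp: strict_mono_on_def h_def; force)
      then have "col_det rs (h ` (V - {w})) \<phi> = col_det rs (V - {w}) (\<lambda>x. \<phi> (h x))"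
        by (rule col_det_reindex)
      moreover have "h ` (V - {w}) = V - {v}" using V(3-5) by (auto simp: h_def)
      moreover have "col_det rs (V - {w}) (\<lambda>x. \<phi> (h x)) = col_det rs (V - {w}) \<phi>"
        by (rule col_det_cong) (simp add: h_def V(6))
      ultimately show ?thesis by simp
    qed
    ultimately show ?thesis by (simp add: V(6))
  qed
  ultimately show ?case by simp
qed auto

lemma sum_PiE_remove:
  fixes F :: "'c \<Rightarrow> ('a \<Rightarrow> 'c) \<Rightarrow> 'b::comm_monoid_add"
  assumes "v \<in> V" and "\<And>d g g'. (\<And>x. x \<in> V - {v} \<Longrightarrow> g x = g' x) \<Longrightarrow> F d g = F d g'"
  shows "(\<Sum>\<psi>\<in>PiE V G. F (\<psi> v) \<psi>) = (\<Sum>d\<in>G v. \<Sum>\<psi>\<in>PiE (V - {v}) G. F d \<psi>)"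
proof -
  have "PiE V G = (\<lambda>(y, g). g(v := y)) ` (G v \<times> PiE (V - {v}) G)"
    using PiE_insert_eq[of v "V - {v}" G] assms(1) by (simp add: insert_absorb)
  moreover have "inj_on (\<lambda>(y, g). g(v := y)) (G v \<times> PiE (V - {v}) G)"
    by (rule inj_combinator) simp
  ultimately have "(\<Sum>\<psi>\<in>PiE V G. F (\<psi> v) \<psi>) = (\<Sum>(d, g)\<in>G v \<times> PiE (V - {v}) G. F d (g(v := d)))"
    by (simp add: sum.reindex case_prod_unfold)
  also have "\<dots> = (\<Sum>(d, g)\<in>G v \<times> PiE (V - {v}) G. F d g)"
  proof (rule sum.cong[OF refl], clarify)
    fix d g
    show "F d (g(v := d)) = F d g" by (rule assms(2)) simp
  qed
  finally show ?thesis by (simp add: sum.cartesian_product)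
qed

text \<open>\<open>T\<close> acts on all rows by the same column operation, so column
  \<open>v\<close> is a sum of the columns in \<open>G v\<close>, and the determinant is expanded
  over all choices.\<close>

lemma col_det_multilinear:
  assumes "finite V" "card V = length rs"
    and "\<And>r v. r \<in> set rs \<Longrightarrow> v \<in> V \<Longrightarrow> T r (\<phi> v) = sum r (G v)"
  shows "col_det (map T rs) V \<phi> = (\<Sum>\<psi>\<in>PiE V G. col_det rs V \<psi>)"
  using assms
proof (induction rs arbitrary: V)
  case (Cons r rs)
  have "(\<Sum>\<psi>\<in>PiE V G. col_det (r # rs) V \<psi>) =
      (\<Sum>v\<in>V. \<Sum>\<psi>\<in>PiE V G. (-1) ^ card {w \<in> V. v < w} * r (\<psi> v) * col_det rs (V - {v}) \<psi>)"
    unfolding col_det.simps by (rule sum.swap)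
  also have "\<dots> = (\<Sum>v\<in>V. \<Sum>d\<in>G v. \<Sum>\<psi>\<in>PiE (V - {v}) G.
      (-1) ^ card {w \<in> V. v < w} * r d * col_det rs (V - {v}) \<psi>)"
  proof (rule sum.cong[OF refl])
    fix v assume "v \<in> V"
    then show "(\<Sum>\<psi>\<in>PiE V G. (-1) ^ card {w \<in> V. v < w} * r (\<psi> v) * col_det rs (V - {v}) \<psi>) =
        (\<Sum>d\<in>G v. \<Sum>\<psi>\<in>PiE (V - {v}) G. (-1) ^ card {w \<in> V. v < w} * r d * col_det rs (V - {v}) \<psi>)"
      by (rule sum_PiE_remove) (metis col_det_cong)
  qed
  also have "\<dots> = (\<Sum>v\<in>V. (-1) ^ card {w \<in> V. v < w} * T r (\<phi> v) * col_det (map T rs) (V - {v}) \<phi>)"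
  proof (rule sum.cong[OF refl])
    fix v assume v: "v \<in> V"
    have "col_det (map T rs) (V - {v}) \<phi> = (\<Sum>\<psi>\<in>PiE (V - {v}) G. col_det rs (V - {v}) \<psi>)"
      by (rule Cons.IH) (use Cons.prems v in auto)
    moreover have "T r (\<phi> v) = sum r (G v)" using Cons.prems v by simp
    ultimately show "(\<Sum>d\<in>G v. \<Sum>\<psi>\<in>PiE (V - {v}) G.
        (-1) ^ card {w \<in> V. v < w} * r d * col_det rs (V - {v}) \<psi>) =
        (-1) ^ card {w \<in> V. v < w} * T r (\<phi> v) * col_det (map T rs) (V - {v}) \<phi>"
      by (simp add: sum_distrib_left sum_distrib_right mult_ac)
  qed
  finally show ?case by simp
qed simp

text \<open>The minor of \<open>B\<close>, with unbounded columns, that belongs to the partition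
  \<open>f\<close>: adding the staircase \<open>n - 1 - v\<close> makes the parts strictly
  decreasing.\<close>

definition shape_det :: "nat \<Rightarrow> (nat \<Rightarrow> nat) \<Rightarrow> real" where
  "shape_det n f = col_det (map binom_row [0..<n]) {..<n} (\<lambda>v. f v + (n - 1 - v))"

text \<open>Pascal's rule, that is, multiplication by \<open>x * (1 + x)\<close>. For
  \<open>q = 1\<close> truncation makes the set a singleton, so its sum rightly has one
  term.\<close>

lemma binom_row_Suc:
  "binom_row (Suc i) q = (if q = 0 then 0 else sum (binom_row i) {q - 1, q - 2})"
proof (cases "q \<le> 1")
  case True
  then consider "q = 0" | "q = 1" by linarith
  then show ?thesis by cases (auto simp: binom_row_def)
next
  case False
  then obtain p where q: "q = Suc (Suc p)" by (metis Suc_le_D add_2_eq_Suc le_add_diff_inverse not_less_eq_eq One_nat_def)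
  show ?thesis
  proof (cases "i \<le> p")
    case True
    then have "q - Suc i = Suc (p - i)" "Suc p - i = Suc (p - i)" by (simp_all add: q Suc_diff_le)
    then show ?thesis using True by (simp add: q binom_row_def)
  next
    case False
    then show ?thesis by (auto simp: q binom_row_def)
  qed
qed

text \<open>Row 0 of \<open>B\<close> is the unit vector of column 0, and only position
  \<open>m\<close> has label 0. Its removal leaves the rows from 1 on.\<close>

lemma shape_det_Suc_eq:
  assumes "antimono f" "f m = 0"
  shows "shape_det (Suc m) f =
    col_det (map (\<lambda>i. binom_row (Suc i)) [0..<m]) {..<m} (\<lambda>v. f v + (m - v))"
proof -
  let ?rs = "map binom_row [Suc 0..<Suc m]" and ?\<phi> = "\<lambda>v. f v + (m - v)"
  have "shape_det (Suc m) f = (\<Sum>v\<in>{..<Suc m}. (-1) ^ card {w \<in> {..<Suc m}. v < w} *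
      binom_row 0 (?\<phi> v) * col_det ?rs ({..<Suc m} - {v}) ?\<phi>)"
    unfolding shape_det_def by (simp add: upt_conv_Cons del: upt_Suc)
  also have "\<dots> = (\<Sum>v\<in>{m}. (-1) ^ card {w \<in> {..<Suc m}. v < w} *
      binom_row 0 (?\<phi> v) * col_det ?rs ({..<Suc m} - {v}) ?\<phi>)"
    by (rule sum.mono_neutral_right) (auto simp: binom_row_def)
  also have "\<dots> = col_det ?rs ({..<Suc m} - {m}) ?\<phi>"
  proof -
    have empty: "{w. w < Suc m \<and> m < w} = {}" by auto
    show ?thesis by (simp add: empty binom_row_def assms(2) del: upt_Suc)
  qed
  also have "?rs = map (\<lambda>i. binom_row (Suc i)) [0..<m]"
    by (simp add: map_Suc_upt[symmetric] del: upt_Suc)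
  also have "{..<Suc m} - {m} = {..<m}" by auto
  finally show ?thesis .
qed

text \<open>All labels are positive, so row 0 vanishes on them.\<close>

lemma shape_det_eq_0_tall:
  assumes "antimono f" "f m \<noteq> 0"
  shows "shape_det (Suc m) f = 0"
proof -
  have "binom_row 0 (f v + (m - v)) = 0" if "v < Suc m" for v
    using antimonoD[OF assms(1), of v m] assms(2) that by (simp add: binom_row_def)
  then show ?thesis
    unfolding shape_det_def by (simp add: upt_conv_Cons del: upt_Suc)
qed

text \<open>The label of position 0 exceeds \<open>2 * m\<close>, while row \<open>i\<close> is
  supported on the columns from \<open>i\<close> to \<open>2 * i\<close>.\<close>

lemma shape_det_eq_0_wide:
  assumes "m < f 0"
  shows "shape_det (Suc m) f = 0"
  unfolding shape_det_def
  by (rule col_det_zero_column[where v = 0]) (use assms in \<open>auto simp: binom_row_def simp del: upt_Suc\<close>)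

text \<open>Every remaining row is a row of the smaller determinant times
  \<open>x * (1 + x)\<close>. Multilinearity lowers each label by 1 or 2; the choices without
  repeated labels are those that remove a vertical strip from \<open>f\<close>.\<close>

lemma shape_det_Suc:
  assumes f: "antimono f" "f m = 0"
  shows "shape_det (Suc m) f =
    (\<Sum>g | antimono g \<and> g m = 0 \<and> (\<forall>v. g v \<le> f v \<and> f v \<le> g v + 1). shape_det m g)"
proof -
  \<comment> \<open>Relative to the smaller staircase \<open>m - 1 - v\<close>, the label
    \<open>q - 1\<close> keeps the part \<open>f v\<close> and \<open>q - 2\<close> lowers it by
    one.\<close>
  define G where "G v = (let q = f v + (m - v) in {q - 1, q - 2})" for v
  let ?P = "{\<psi> \<in> PiE {..<m} G. \<forall>v w. v < w \<and> w < m \<longrightarrow> \<psi> w < \<psi> v}"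
  let ?Q = "{g. antimono g \<and> g m = 0 \<and> (\<forall>v. g v \<le> f v \<and> f v \<le> g v + 1)}"
  let ?T = "\<lambda>r q. if q = 0 then 0 else sum r {q - 1, q - 2}"
  let ?rs = "map binom_row [0..<m]"
  have fm: "f v \<ge> f w" if "v \<le> w" for v w using antimonoD[OF f(1) that] .
  have "shape_det (Suc m) f = col_det (map ?T ?rs) {..<m} (\<lambda>v. f v + (m - v))"
    unfolding shape_det_Suc_eq[OF f] map_map by (simp add: o_def binom_row_Suc[abs_def])
  also have "\<dots> = (\<Sum>\<psi>\<in>PiE {..<m} G. col_det ?rs {..<m} \<psi>)"
    by (rule col_det_multilinear) (auto simp: G_def Let_def)
  also have "\<dots> = (\<Sum>\<psi>\<in>?P. col_det ?rs {..<m} \<psi>)"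
  proof (rule sum.mono_neutral_right)
    show "finite (PiE {..<m} G)" by (rule finite_PiE) (auto simp: G_def Let_def)
    show "\<forall>\<psi>\<in>PiE {..<m} G - ?P. col_det ?rs {..<m} \<psi> = 0"
    proof
      fix \<psi> assume \<psi>: "\<psi> \<in> PiE {..<m} G - ?P"
      have "\<exists>v. Suc v < m \<and> \<not> \<psi> (Suc v) < \<psi> v"
      proof (rule ccontr)
        assume "\<not> ?thesis"
        then have step: "\<psi> (Suc v) < \<psi> v" if "Suc v < m" for v using that by blast
        have "\<psi> w < \<psi> v" if "v < w" "w < m" for v w
          using that
        proof (induction w)
          case (Suc w)
          show ?case
          proof (cases "v = w")
            case False
            then have "\<psi> w < \<psi> v" using Suc by simp
            then show ?thesis using step[of w] Suc.prems by simp
          qed (use step[of w] Suc.prems in simp)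
        qed simp
        then show False using \<psi> by blast
      qed
      then obtain v where v: "Suc v < m" "\<not> \<psi> (Suc v) < \<psi> v" by blast
      have "\<psi> v \<in> G v" "\<psi> (Suc v) \<in> G (Suc v)" using \<psi> v(1) by (auto simp: PiE_def Pi_def)
      \<comment> \<open>Neighbouring labels start at least 1 apart and drop by 1 or 2, so they can
        meet but not cross. A choice that fails to decrease strictly thus has two equal neighbouring
        columns.\<close>
      then have "\<psi> (Suc v) \<le> \<psi> v" using fm[of v "Suc v"] v(1) by (auto simp: G_def Let_def)
      then have "\<psi> v = \<psi> (Suc v)" using v(2) by simp
      then show "col_det ?rs {..<m} \<psi> = 0"
        by (intro col_det_repeated_column[where v = v and w = "Suc v"]) (use v in auto)
    qed
  qed blast
  also have "\<dots> = (\<Sum>g\<in>?Q. shape_det m g)"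
  proof (rule sum.reindex_bij_witness[where
        i = "\<lambda>g. restrict (\<lambda>v. g v + (m - 1 - v)) {..<m}" and
        j = "\<lambda>\<psi> v. if v < m then \<psi> v - (m - 1 - v) else 0"])
    fix \<psi> assume "\<psi> \<in> ?P"
    then have \<psi>: "\<psi> \<in> PiE {..<m} G" and dec: "\<And>v w. v < w \<Longrightarrow> w < m \<Longrightarrow> \<psi> w < \<psi> v" by blast+
    have gap: "\<psi> (v + d) + d \<le> \<psi> v" if "v + d < m" for v d
      using that
    proof (induction d)
      case (Suc d)
      then show ?case using dec[of "v + d" "v + Suc d"] by simp
    qed simp
    \<comment> \<open>Strict decrease keeps the labels above the staircase, so subtracting it loses
      nothing.\<close>
    have ge: "m - 1 - v \<le> \<psi> v" if "v < m" for v
      using gap[of v "m - 1 - v"] that by simp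
    let ?g = "\<lambda>v. if v < m then \<psi> v - (m - 1 - v) else 0"
    show "restrict (\<lambda>v. ?g v + (m - 1 - v)) {..<m} = \<psi>"
    proof
      fix v show "restrict (\<lambda>v. ?g v + (m - 1 - v)) {..<m} v = \<psi> v"
        using \<psi> ge[of v] by (auto simp: PiE_def extensional_def)
    qed
    have "?g w \<le> ?g v" if "v \<le> w" for v w
      using gap[of v "w - v"] ge[of w] that by auto
    then have "antimono ?g" by (rule antimonoI)
    moreover have "?g v \<le> f v \<and> f v \<le> ?g v + 1" for v
    proof (cases "v < m")
      case True
      then have "\<psi> v \<in> G v" using \<psi> by auto
      then show ?thesis using True ge[of v] by (auto simp: G_def Let_def)
    next
      case False
      then show ?thesis using fm[of m v] f(2) by simp
    qed
    ultimately show "?g \<in> ?Q" by simp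
    show "shape_det m ?g = col_det ?rs {..<m} \<psi>"
      unfolding shape_det_def
    proof (rule col_det_cong)
      fix v assume "v \<in> {..<m}"
      then show "?g v + (m - 1 - v) = \<psi> v"
        using ge[of v] by (simp only: lessThan_iff if_True le_add_diff_inverse2)
    qed
  next
    fix g assume g: "g \<in> ?Q"
    then have gm: "g v \<ge> g w" if "v \<le> w" for v w using antimonoD that by blast
    show "(\<lambda>v. if v < m then restrict (\<lambda>v. g v + (m - 1 - v)) {..<m} v - (m - 1 - v) else 0) = g"
    proof
      fix v show "(if v < m then restrict (\<lambda>v. g v + (m - 1 - v)) {..<m} v - (m - 1 - v) else 0) = g v"
        using gm[of m v] g by auto
    qed
    have "g v + (m - 1 - v) \<in> G v" if "v < m" for v
    proof -
      have "g v = f v \<or> f v = g v + 1" using g by (simp add: le_Suc_eq) (metis le_antisym)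
      then show ?thesis using that by (auto simp: G_def Let_def)
    qed
    moreover have "g w + (m - 1 - w) < g v + (m - 1 - v)" if "v < w" "w < m" for v w
      using gm[of v w] that by linarith
    ultimately show "restrict (\<lambda>v. g v + (m - 1 - v)) {..<m} \<in> ?P" by auto
  qed
  finally show ?thesis .
qed

section \<open>Triangular arrays\<close>

text \<open>Young diagrams with at most \<open>b\<close> rows of length at most \<open>a\<close>, as
  infinite sequences so that boxes of different size share one type of object.\<close>

definition partitions :: "nat \<Rightarrow> nat \<Rightarrow> (nat \<Rightarrow> nat) set" where
  "partitions a b = {f. antimono f \<and> f 0 \<le> a \<and> f b = 0}"

text \<open>The conjugate partition: for decreasing \<open>f\<close> the least such index is the
  number of parts exceeding \<open>v\<close>.\<close>

definition transposed :: "(nat \<Rightarrow> nat) \<Rightarrow> nat \<Rightarrow> nat" where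
  "transposed f v = (LEAST r. f r \<le> v)"

lemma partitions_mono:
  assumes "a \<le> a'" "b \<le> b'"
  shows "partitions a b \<subseteq> partitions a' b'"
  using assms by (auto simp: partitions_def dest: antimonoD[of _ b b'])

text \<open>Both sides say that the cell \<open>(r, v)\<close> lies in the diagram. The facts on
  conjugation below rest on this symmetry.\<close>

lemma less_transposed_iff:
  assumes "f \<in> partitions a b"
  shows "r < transposed f v \<longleftrightarrow> v < f r"
proof -
  have f: "antimono f" "f b \<le> v" using assms by (auto simp: partitions_def)
  have "f (transposed f v) \<le> v" unfolding transposed_def by (rule LeastI[where P = "\<lambda>r. f r \<le> v", OF f(2)])
  then have "f r \<le> v" if "transposed f v \<le> r" using antimonoD[OF f(1) that] by linarith
  moreover have "v < f r" if "r < transposed f v"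
    using not_less_Least[OF that[unfolded transposed_def]] by simp
  ultimately show ?thesis by (metis not_less)
qed

lemma transposed_partitions:
  assumes "f \<in> partitions a b"
  shows "transposed f \<in> partitions b a"
proof -
  note iff = less_transposed_iff[OF assms]
  have "transposed f w \<le> transposed f v" if "v \<le> w" for v w
    using that iff[of "transposed f v" v] iff[of "transposed f v" w] by linarith
  then have "antimono (transposed f)" by (rule antimonoI)
  moreover have "transposed f 0 \<le> b"
    using assms iff[of b 0] by (simp add: partitions_def not_less)
  moreover have "transposed f a = 0"
    using assms iff[of 0 a] by (simp add: partitions_def)
  ultimately show ?thesis by (simp add: partitions_def)
qed

lemma transposed_transposed:
  assumes "f \<in> partitions a b"
  shows "transposed (transposed f) = f"
proof
  fix r
  have "v < transposed (transposed f) r \<longleftrightarrow> v < f r" for v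
    using less_transposed_iff[OF assms] less_transposed_iff[OF transposed_partitions[OF assms]] by blast
  then show "transposed (transposed f) r = f r" by (metis less_irrefl linorder_neqE_nat)
qed

lemma finite_partitions: "finite (partitions a b)"
proof (rule finite_subset)
  show "partitions a b \<subseteq> {f. \<forall>r. (r \<in> {..<b} \<longrightarrow> f r \<in> {..a}) \<and> (r \<notin> {..<b} \<longrightarrow> f r = 0)}"
  proof
    fix f assume "f \<in> partitions a b"
    then have f: "antimono f" "f 0 \<le> a" "f b = 0" by (auto simp: partitions_def)
    show "f \<in> {f. \<forall>r. (r \<in> {..<b} \<longrightarrow> f r \<in> {..a}) \<and> (r \<notin> {..<b} \<longrightarrow> f r = 0)}"
      using antimonoD[OF f(1), of 0] antimonoD[OF f(1), of b] f(2,3)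
      by (auto simp: not_less intro: order_trans)
  qed
qed (rule finite_set_of_finite_funs, auto)

text \<open>Neighbouring rows of a Gelfand-Tsetlin pattern: the diagram of \<open>f\<close> arises
  from that of \<open>g\<close> by adding a horizontal strip.\<close>

definition interlaces :: "(nat \<Rightarrow> nat) \<Rightarrow> (nat \<Rightarrow> nat) \<Rightarrow> bool" where
  "interlaces g f \<longleftrightarrow> (\<forall>r. g r \<le> f r \<and> f (Suc r) \<le> g r)"

text \<open>Conjugation turns horizontal strips into vertical ones; each inequality is checked on
  single cells.\<close>

lemma interlaces_iff_transposed:
  assumes f: "f \<in> partitions a b" and g: "g \<in> partitions a' b'"
  shows "interlaces g f \<longleftrightarrow>
    (\<forall>v. transposed g v \<le> transposed f v \<and> transposed f v \<le> transposed g v + 1)"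
proof -
  note iff = less_transposed_iff[OF f] less_transposed_iff[OF g]
  show ?thesis
  proof
    assume i: "interlaces g f"
    show "\<forall>v. transposed g v \<le> transposed f v \<and> transposed f v \<le> transposed g v + 1"
    proof (intro allI conjI)
      fix v
      let ?c = "transposed f v"
      show "transposed g v \<le> transposed f v"
      proof (rule ccontr)
        assume "\<not> ?thesis"
        then have "v < g ?c" using iff(2)[of ?c v] by simp
        also have "g ?c \<le> f ?c" using i by (simp add: interlaces_def)
        finally show False using iff(1)[of ?c v] by simp
      qed
      let ?d = "transposed g v"
      show "transposed f v \<le> transposed g v + 1"
      proof (rule ccontr)
        assume "\<not> ?thesis"
        then have "v < f (Suc ?d)" using iff(1)[of "Suc ?d" v] by simp
        also have "f (Suc ?d) \<le> g ?d" using i by (simp add: interlaces_def)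
        finally show False using iff(2)[of ?d v] by simp
      qed
    qed
  next
    assume c: "\<forall>v. transposed g v \<le> transposed f v \<and> transposed f v \<le> transposed g v + 1"
    show "interlaces g f"
      unfolding interlaces_def
    proof (intro allI conjI)
      fix r
      show "g r \<le> f r"
      proof (rule ccontr)
        assume "\<not> ?thesis"
        then have "r < transposed g (f r)" using iff(2)[of r "f r"] by simp
        then show False using c iff(1)[of r "f r"] by (metis less_irrefl less_le_trans)
      qed
      show "f (Suc r) \<le> g r"
      proof (rule ccontr)
        assume "\<not> ?thesis"
        then have "Suc r < transposed f (g r)" using iff(1)[of "Suc r" "g r"] by simp
        moreover have "transposed f (g r) \<le> transposed g (g r) + 1" using c by simp
        ultimately have "r < transposed g (g r)" by simp
        then show False using iff(2)[of r "g r"] by simp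
      qed
    qed
  qed
qed

text \<open>The complements \<open>c i j = n - b i j\<close> of the arrays with \<open>n = m + 1\<close>.\<close>

definition arrays :: "nat \<Rightarrow> (nat \<Rightarrow> nat \<Rightarrow> nat) set" where
  "arrays m = {c. (\<forall>i j. \<not> (1 \<le> i \<and> i \<le> j \<and> j \<le> m) \<longrightarrow> c i j = 0) \<and> (\<forall>i j. c i j \<le> i) \<and>
     (\<forall>i j j'. 1 \<le> i \<and> i \<le> j \<and> j \<le> j' \<and> j' \<le> m \<longrightarrow> c i j \<le> c i j') \<and>
     (\<forall>i i' j. 1 \<le> i \<and> i \<le> i' \<and> i' \<le> j \<and> j \<le> m \<longrightarrow> c i j \<le> c i' j)}"

text \<open>Read from the last entry upwards, so that the main diagonal decreases.\<close>

definition diagonal :: "nat \<Rightarrow> (nat \<Rightarrow> nat \<Rightarrow> nat) \<Rightarrow> nat \<Rightarrow> nat" where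
  "diagonal m c r = (if r < m then c (m - r) (m - r) else 0)"

section \<open>Peeling off main diagonals\<close>

lemma arraysD:
  assumes "c \<in> arrays m"
  shows "\<not> (1 \<le> i \<and> i \<le> j \<and> j \<le> m) \<Longrightarrow> c i j = 0"
    and "c i j \<le> i"
    and "1 \<le> i \<Longrightarrow> i \<le> j \<Longrightarrow> j \<le> j' \<Longrightarrow> j' \<le> m \<Longrightarrow> c i j \<le> c i j'"
    and "1 \<le> i \<Longrightarrow> i \<le> i' \<Longrightarrow> i' \<le> j \<Longrightarrow> j \<le> m \<Longrightarrow> c i j \<le> c i' j"
  using assms unfolding arrays_def by blast+

lemma finite_arrays: "finite (arrays m)"
proof -
  let ?F = "{h. \<forall>x. (x \<in> {..m} \<times> {..m} \<longrightarrow> h x \<in> {..m}) \<and> (x \<notin> {..m} \<times> {..m} \<longrightarrow> h x = (0::nat))}"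
  have "finite ?F" by (rule finite_set_of_finite_funs) auto
  moreover have "case_prod ` arrays m \<subseteq> ?F"
  proof (intro image_subsetI CollectI allI)
    fix c and x :: "nat \<times> nat" assume c: "c \<in> arrays m"
    obtain i j where x: "x = (i, j)" by (cases x)
    show "(x \<in> {..m} \<times> {..m} \<longrightarrow> case_prod c x \<in> {..m}) \<and> (x \<notin> {..m} \<times> {..m} \<longrightarrow> case_prod c x = 0)"
      using arraysD(1)[OF c, of i j] arraysD(2)[OF c, of i j] by (auto simp: x)
  qed
  ultimately have "finite (case_prod ` arrays m)" by (rule finite_subset[rotated])
  then show ?thesis
    by (rule finite_imageD) (auto simp: inj_on_def fun_eq_iff)
qed

lemma diagonal_partitions:
  assumes "c \<in> arrays m"
  shows "diagonal m c \<in> partitions m m"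
proof -
  have "diagonal m c s \<le> diagonal m c r" if "r \<le> s" for r s
  proof (cases "s < m")
    case True
    \<comment> \<open>Go along row \<open>m - s\<close> and then down column
      \<open>m - r\<close>.\<close>
    have "c (m - s) (m - s) \<le> c (m - s) (m - r)"
      by (rule arraysD(3)[OF assms]) (use True that in auto)
    also have "\<dots> \<le> c (m - r) (m - r)"
      by (rule arraysD(4)[OF assms]) (use True that in auto)
    finally show ?thesis using True that by (simp add: diagonal_def)
  qed (simp add: diagonal_def)
  then have "antimono (diagonal m c)" by (rule antimonoI)
  then show ?thesis using arraysD(2)[OF assms, of m m] by (simp add: partitions_def diagonal_def)
qed

text \<open>Deleting the main diagonal and moving all rows one step to the left gives an array of
  size \<open>m\<close>. The monotonicity conditions between the first two diagonals are exactly the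
  interlacing of the two partitions.\<close>

lemma card_arrays_Suc:
  assumes f: "f \<in> partitions (Suc m) (Suc m)"
  shows "card {c \<in> arrays (Suc m). diagonal (Suc m) c = f} =
    card {c \<in> arrays m. interlaces (diagonal m c) f}"
proof -
  let ?del = "\<lambda>c i j. if 1 \<le> i \<and> i \<le> j \<and> j \<le> m then c i (Suc j) else (0::nat)"
  let ?ins = "\<lambda>c i j. if i = j then (if 1 \<le> i \<and> i \<le> Suc m then f (Suc m - i) else 0)
      else if 1 \<le> i \<and> i < j \<and> j \<le> Suc m then c i (j - 1) else (0::nat)"
  have "bij_betw ?del {c \<in> arrays (Suc m). diagonal (Suc m) c = f}
      {c \<in> arrays m. interlaces (diagonal m c) f}"
  proof (rule bij_betw_byWitness[where f' = ?ins])
    show "\<forall>c\<in>{c \<in> arrays (Suc m). diagonal (Suc m) c = f}. ?ins (?del c) = c"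
    proof
      fix c assume "c \<in> {c \<in> arrays (Suc m). diagonal (Suc m) c = f}"
      then have c: "c \<in> arrays (Suc m)" and d: "f = diagonal (Suc m) c" by auto
      show "?ins (?del c) = c"
      proof (intro ext)
        fix i j
        show "?ins (?del c) i j = c i j"
          using arraysD(1)[OF c, of i j] arraysD(1)[OF c, of j j] by (auto simp: d diagonal_def)
      qed
    qed
    show "\<forall>c\<in>{c \<in> arrays m. interlaces (diagonal m c) f}. ?del (?ins c) = c"
    proof
      fix c assume "c \<in> {c \<in> arrays m. interlaces (diagonal m c) f}"
      then have c: "c \<in> arrays m" by auto
      show "?del (?ins c) = c"
      proof (intro ext)
        fix i j
        show "?del (?ins c) i j = c i j" using arraysD(1)[OF c, of i j] by auto
      qed
    qed
    show "?del ` {c \<in> arrays (Suc m). diagonal (Suc m) c = f} \<subseteq> {c \<in> arrays m. interlaces (diagonal m c) f}"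
    proof (rule image_subsetI)
      fix c assume "c \<in> {c \<in> arrays (Suc m). diagonal (Suc m) c = f}"
      then have c: "c \<in> arrays (Suc m)" and d: "f = diagonal (Suc m) c" by auto
      have "?del c \<in> arrays m"
        unfolding arrays_def using arraysD(2-4)[OF c] by auto
      moreover have "interlaces (diagonal m (?del c)) f"
        unfolding interlaces_def
      proof (intro allI conjI)
        fix r
        show "diagonal m (?del c) r \<le> f r"
        proof (cases "r < m")
          case True
          have "c (m - r) (Suc m - r) \<le> c (Suc m - r) (Suc m - r)"
            by (rule arraysD(4)[OF c]) (use True in auto)
          then show ?thesis using True by (simp add: d diagonal_def Suc_diff_le)
        qed (simp add: diagonal_def)
        show "f (Suc r) \<le> diagonal m (?del c) r"
        proof (cases "r < m")
          case True
          have "c (m - r) (m - r) \<le> c (m - r) (Suc m - r)"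
            by (rule arraysD(3)[OF c]) (use True in auto)
          then show ?thesis using True by (simp add: d diagonal_def Suc_diff_le)
        qed (simp add: d diagonal_def)
      qed
      ultimately show "?del c \<in> {c \<in> arrays m. interlaces (diagonal m c) f}" by simp
    qed
    show "?ins ` {c \<in> arrays m. interlaces (diagonal m c) f} \<subseteq> {c \<in> arrays (Suc m). diagonal (Suc m) c = f}"
    proof (rule image_subsetI)
      fix c assume "c \<in> {c \<in> arrays m. interlaces (diagonal m c) f}"
      then have c: "c \<in> arrays m" and lo: "\<And>r. diagonal m c r \<le> f r" and hi: "\<And>r. f (Suc r) \<le> diagonal m c r"
        by (auto simp: interlaces_def)
      \<comment> \<open>A new diagonal entry lies left of the old entry \<open>(i, i)\<close>, and
        below the old entry \<open>(i - 1, i - 1)\<close>; these are the two halves of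
        interlacing.\<close>
      have f_hi: "f (Suc m - i) \<le> c i i" if "1 \<le> i" "i \<le> m" for i
        using hi[of "m - i"] that by (simp add: diagonal_def Suc_diff_le)
      have f_lo: "c j j \<le> f (m - j)" if "1 \<le> j" "j \<le> m" for j
        using lo[of "m - j"] that by (simp add: diagonal_def)
      have "?ins c i j \<le> i" for i j
      proof -
        \<comment> \<open>Interlacing passes the bound on from the old diagonal; the new corner
          \<open>Suc m\<close> is bounded by the box of \<open>f\<close>.\<close>
        have "f (Suc m - i) \<le> i" if "1 \<le> i" "i \<le> Suc m"
        proof (cases "i = Suc m")
          case True
          then show ?thesis using f by (simp add: partitions_def)
        next
          case False
          then show ?thesis using f_hi[of i] that arraysD(2)[OF c, of i i] by simp
        qed
        then show ?thesis using arraysD(2)[OF c, of i "j - 1"] by auto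
      qed
      moreover have "?ins c i j \<le> ?ins c i j'" if "1 \<le> i" "i \<le> j" "j \<le> j'" "j' \<le> Suc m" for i j j'
      proof (cases "i = j")
        case False
        then show ?thesis using that arraysD(3)[OF c, of i "j - 1" "j' - 1"] by auto
      next
        case True
        show ?thesis
        proof (cases "j = j'")
          case False
          then have "f (Suc m - i) \<le> c i i" using True that by (intro f_hi) auto
          also have "c i i \<le> c i (j' - 1)"
            by (rule arraysD(3)[OF c]) (use True False that in auto)
          finally show ?thesis using True False that by auto
        qed simp
      qed
      moreover have "?ins c i j \<le> ?ins c i' j" if "1 \<le> i" "i \<le> i'" "i' \<le> j" "j \<le> Suc m" for i i' j
      proof (cases "i' = j")
        case False
        then show ?thesis using that arraysD(4)[OF c, of i i' "j - 1"] by auto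
      next
        case True
        show ?thesis
        proof (cases "i = j")
          case False
          then have "c i (j - 1) \<le> c (j - 1) (j - 1)"
            by (intro arraysD(4)[OF c]) (use True that in auto)
          also have "\<dots> \<le> f (m - (j - 1))"
            by (rule f_lo) (use True False that in auto)
          finally show ?thesis using True False that by auto
        qed (use True in simp)
      qed
      moreover have "?ins c i j = 0" if "\<not> (1 \<le> i \<and> i \<le> j \<and> j \<le> Suc m)" for i j
        using that by auto
      ultimately have "?ins c \<in> arrays (Suc m)" unfolding arrays_def by blast
      moreover have "diagonal (Suc m) (?ins c) = f"
      proof
        fix r
        show "diagonal (Suc m) (?ins c) r = f r"
        proof (cases "r < Suc m")
          case False
          then have "f r = 0" using f antimonoD[of f "Suc m" r] by (simp add: partitions_def)
          then show ?thesis using False by (simp add: diagonal_def)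
        qed (simp add: diagonal_def)
      qed
      ultimately show "?ins c \<in> {c \<in> arrays (Suc m). diagonal (Suc m) c = f}" by simp
    qed
  qed
  then show ?thesis by (rule bij_betw_same_card)
qed

lemma card_eq_sum_fibres:
  assumes "finite A" "finite B" "h ` A \<subseteq> B"
  shows "card A = (\<Sum>y\<in>B. card {x \<in> A. h x = y})"
  using sum.group[OF assms, of "\<lambda>_. 1::nat"] by simp

lemma sum_transposed:
  "(\<Sum>f\<in>partitions a b. F (transposed f)) = (\<Sum>g\<in>partitions b a. F g)"
  by (rule sum.reindex_bij_witness[where i = transposed and j = transposed])
    (auto simp: transposed_transposed intro: transposed_partitions)

text \<open>Both sides obey the same recursion: the count sums over interlacing diagonals, the
  determinant over vertical strips, and conjugation exchanges the two. For \<open>m = 0\<close> both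
  are 1.\<close>

theorem card_arrays_diagonal:
  assumes "f \<in> partitions m m"
  shows "real (card {c \<in> arrays m. diagonal m c = f}) = shape_det (Suc m) (transposed f)"
  using assms
proof (induction m arbitrary: f)
  case 0
  then have f: "f = (\<lambda>_. 0)" by (auto simp: partitions_def fun_eq_iff dest: antimonoD[of f 0])
  have "arrays 0 = {\<lambda>_ _. 0}" by (auto simp: arrays_def fun_eq_iff)
  then have "{c \<in> arrays 0. diagonal 0 c = f} = {\<lambda>_ _. 0}"
    by (auto simp: f diagonal_def fun_eq_iff)
  moreover have "transposed f = (\<lambda>_. 0)" by (auto simp: f transposed_def)
  moreover have empty: "{w. w = 0 \<and> 0 < w} = ({} :: nat set)" by auto
  ultimately show ?case by (simp add: empty shape_det_def binom_row_def)
next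
  case (Suc m)
  note f = Suc.prems
  let ?vert = "\<lambda>h. \<forall>v. h v \<le> transposed f v \<and> transposed f v \<le> h v + 1"
  let ?Q = "{h. antimono h \<and> h (Suc m) = 0 \<and> ?vert h}"
  have cf: "antimono (transposed f)" "transposed f (Suc m) = 0" "transposed f 0 \<le> Suc m"
    using transposed_partitions[OF f] by (auto simp: partitions_def)
  have "card {c \<in> arrays (Suc m). diagonal (Suc m) c = f} =
      card {c \<in> arrays m. interlaces (diagonal m c) f}"
    by (rule card_arrays_Suc[OF f])
  also have "\<dots> = (\<Sum>g\<in>partitions m m. card {c \<in> {c \<in> arrays m. interlaces (diagonal m c) f}. diagonal m c = g})"
    by (rule card_eq_sum_fibres)
      (auto simp: finite_arrays finite_partitions intro: diagonal_partitions)
  also have "real \<dots> = (\<Sum>g\<in>partitions m m. if interlaces g f then shape_det (Suc m) (transposed g) else 0)"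
    unfolding of_nat_sum
  proof (rule sum.cong[OF refl])
    fix g assume g: "g \<in> partitions m m"
    have "{c \<in> {c \<in> arrays m. interlaces (diagonal m c) f}. diagonal m c = g} =
        (if interlaces g f then {c \<in> arrays m. diagonal m c = g} else {})" by auto
    then show "real (card {c \<in> {c \<in> arrays m. interlaces (diagonal m c) f}. diagonal m c = g}) =
        (if interlaces g f then shape_det (Suc m) (transposed g) else 0)"
      using Suc.IH[OF g] by simp
  qed
  also have "\<dots> = (\<Sum>g\<in>partitions m m. if ?vert (transposed g) then shape_det (Suc m) (transposed g) else 0)"
    by (rule sum.cong[OF refl]) (simp only: interlaces_iff_transposed[OF f])
  also have "\<dots> = (\<Sum>h\<in>partitions m m. if ?vert h then shape_det (Suc m) h else 0)"
    by (rule sum_transposed)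
  also have "\<dots> = (\<Sum>h\<in>{h \<in> partitions m m. ?vert h}. shape_det (Suc m) h)"
    by (rule sum.inter_filter[symmetric, OF finite_partitions])
  \<comment> \<open>The determinant recursion allows strips in a box larger by one; the additional
    shapes are too wide or too tall and have determinant 0.\<close>
  also have "\<dots> = (\<Sum>h\<in>?Q. shape_det (Suc m) h)"
  proof (rule sum.mono_neutral_left)
    show "finite ?Q"
    proof (rule finite_subset[OF _ finite_partitions])
      show "?Q \<subseteq> partitions (Suc m) (Suc m)"
        using cf(3) by (auto simp: partitions_def intro: order_trans)
    qed
    show "{h \<in> partitions m m. ?vert h} \<subseteq> ?Q"
      using partitions_mono[of m m m "Suc m"] by (auto simp: partitions_def)
    show "\<forall>h\<in>?Q - {h \<in> partitions m m. ?vert h}. shape_det (Suc m) h = 0"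
    proof
      fix h assume "h \<in> ?Q - {h \<in> partitions m m. ?vert h}"
      then have h: "antimono h" "h \<notin> partitions m m" by blast+
      then have "m < h 0 \<or> h m \<noteq> 0" by (auto simp: partitions_def)
      with h(1) show "shape_det (Suc m) h = 0"
        using shape_det_eq_0_wide shape_det_eq_0_tall by blast
    qed
  qed
  also have "\<dots> = shape_det (Suc (Suc m)) (transposed f)"
    by (rule shape_det_Suc[symmetric, OF cf(1,2)])
  finally show ?case .
qed

section \<open>Summing over shapes, and the arrays of the theorem\<close>

lemma image_reflect_lessThan: "(\<lambda>v. n - 1 - v) ` {..<n} = {..<n}" for n :: nat
proof (intro equalityI subsetI)
  fix x assume "x \<in> {..<n}"
  then have "x = n - 1 - (n - 1 - x)" "n - 1 - x \<in> {..<n}" by auto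
  then show "x \<in> (\<lambda>v. n - 1 - v) ` {..<n}" by blast
qed auto

text \<open>Subtracting the staircase from the decreasing list of an \<open>n\<close>-subset of
  \<open>{..<n + k}\<close> leaves a partition into at most \<open>n\<close> parts of size at most
  \<open>k\<close>, and conversely.\<close>

lemma sum_row_det_eq_sum_shape_det:
  "(\<Sum>I | I \<subseteq> {..<n + k} \<and> card I = n. row_det (map binom_row [0..<n]) I) =
    (\<Sum>h\<in>partitions k n. shape_det n h)"
proof (rule sum.reindex_bij_witness[where
      i = "\<lambda>h. (\<lambda>v. h v + (n - 1 - v)) ` {..<n}" and
      j = "\<lambda>I v. if v < n then sorted_list_of_set I ! (n - 1 - v) - (n - 1 - v) else 0"])
  fix I assume "I \<in> {I. I \<subseteq> {..<n + k} \<and> card I = n}"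
  then have I: "I \<subseteq> {..<n + k}" "card I = n" "finite I" by (auto intro: finite_subset)
  define l where "l = sorted_list_of_set I"
  \<comment> \<open>The sorted list increases, so part \<open>v\<close> is read from position
    \<open>n - 1 - v\<close>.\<close>
  let ?h = "\<lambda>v. if v < n then l ! (n - 1 - v) - (n - 1 - v) else 0"
  have l: "length l = n" "set l = I" "sorted_wrt (<) l"
    using I by (simp_all add: l_def)
  have gap: "l ! a + d \<le> l ! (a + d)" if "a + d < n" for a d
    using that
  proof (induction d)
    case (Suc d)
    then show ?case using sorted_wrt_nth_less[OF l(3), of "a + d" "a + Suc d"] l(1) by simp
  qed simp
  have ge: "a \<le> l ! a" if "a < n" for a using gap[of 0 a] that by simp
  have enum: "?h v + (n - 1 - v) = l ! (n - 1 - v)" if "v < n" for v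
    using ge[of "n - 1 - v"] that by simp
  have "(\<lambda>v. ?h v + (n - 1 - v)) ` {..<n} = (\<lambda>v. l ! (n - 1 - v)) ` {..<n}"
    by (rule image_cong[OF refl]) (use enum in blast)
  also have "\<dots> = (\<lambda>a. l ! a) ` {..<n}"
  proof -
    have "(\<lambda>v. l ! (n - 1 - v)) ` {..<n} = (\<lambda>a. l ! a) ` ((\<lambda>v. n - 1 - v) ` {..<n})"
      by (simp only: image_image)
    then show ?thesis by (simp only: image_reflect_lessThan)
  qed
  also have "\<dots> = I" using l(1,2) by (auto simp: set_conv_nth)
  finally show img: "(\<lambda>v. ?h v + (n - 1 - v)) ` {..<n} = I" .
  have "?h w \<le> ?h v" if "v \<le> w" for v w
    using gap[of "n - 1 - w" "w - v"] that by auto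
  then have "antimono ?h" by (rule antimonoI)
  moreover have "?h 0 \<le> k"
  proof (cases "n = 0")
    case False
    then have "l ! (n - 1) \<in> I" using l nth_mem[of "n - 1" l] by simp
    then show ?thesis using I(1) by auto
  qed simp
  ultimately show "?h \<in> partitions k n" by (simp add: partitions_def)
  have dec: "?h w + (n - 1 - w) < ?h v + (n - 1 - v)" if "v \<in> {..<n}" "w \<in> {..<n}" "v < w" for v w
  proof -
    have "l ! (n - 1 - w) < l ! (n - 1 - v)"
      by (rule sorted_wrt_nth_less[OF l(3)]) (use that l(1) in auto)
    then show ?thesis using enum[of v] enum[of w] that by (simp only: lessThan_iff)
  qed
  have "row_det (map binom_row [0..<n]) ((\<lambda>v. ?h v + (n - 1 - v)) ` {..<n}) = shape_det n ?h"
    unfolding shape_det_def by (rule row_det_image) (rule dec)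
  then show "shape_det n ?h = row_det (map binom_row [0..<n]) I" unfolding img by simp
next
  fix h assume "h \<in> partitions k n"
  then have h: "antimono h" "h 0 \<le> k" "h n = 0" by (auto simp: partitions_def)
  let ?\<phi> = "\<lambda>v. h v + (n - 1 - v)"
  have dec: "?\<phi> w < ?\<phi> v" if "v < w" "w < n" for v w
    using antimonoD[OF h(1), of v w] that by linarith
  let ?l = "map (\<lambda>a. ?\<phi> (n - 1 - a)) [0..<n]"
  have "h (n - Suc i) + i < h (n - Suc j) + j" if "i < j" "j < n" for i j
    using dec[of "n - 1 - j" "n - 1 - i"] that by simp
  then have "sorted_wrt (<) ?l" by (auto simp: sorted_wrt_iff_nth_less)
  moreover have set: "set ?l = ?\<phi> ` {..<n}"
  proof -
    have "set ?l = ?\<phi> ` ((\<lambda>v. n - 1 - v) ` {..<n})"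
      by (simp only: image_image set_map set_upt atLeast0LessThan)
    then show ?thesis by (simp only: image_reflect_lessThan)
  qed
  ultimately have l: "sorted_list_of_set (?\<phi> ` {..<n}) = ?l"
    by (metis sorted_list_of_set.idem_if_sorted_distinct strict_sorted_iff)
  show "(\<lambda>v. if v < n then sorted_list_of_set (?\<phi> ` {..<n}) ! (n - 1 - v) - (n - 1 - v) else 0) = h"
  proof
    fix v
    show "(if v < n then sorted_list_of_set (?\<phi> ` {..<n}) ! (n - 1 - v) - (n - 1 - v) else 0) = h v"
      unfolding l using antimonoD[OF h(1), of n v] h(3) by auto
  qed
  have "inj_on ?\<phi> {..<n}"
    by (rule inj_onI) (metis dec lessThan_iff less_irrefl linorder_neqE_nat)
  then have "card (?\<phi> ` {..<n}) = n" by (simp only: card_image card_lessThan)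
  moreover have "?\<phi> v < n + k" if "v < n" for v
    using antimonoD[OF h(1), of 0 v] h(2) that by linarith
  ultimately show "?\<phi> ` {..<n} \<in> {I. I \<subseteq> {..<n + k} \<and> card I = n}" by auto
qed

text \<open>After complementing, the prescribed columns have to vanish. Their largest entry is
  \<open>c (m - k) (m - k)\<close>, so one equation suffices; for \<open>k = m\<close> there is no
  such column and \<open>diagonal\<close> is 0 by default.\<close>

lemma card_T_arrays_k:
  assumes "k \<le> m"
  shows "card (T_arrays_k (Suc m) k) = card {c \<in> arrays m. diagonal m c k = 0}"
proof -
  let ?cell = "\<lambda>i j. 1 \<le> i \<and> i \<le> j \<and> j \<le> m"
  let ?to = "\<lambda>b i j. if ?cell i j then nat (int (Suc m) - b (i, j)) else 0"
  let ?from = "\<lambda>c (i, j). if ?cell i j then int (Suc m) - int (c i j) else undefined"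
  have cells: "(i, j) \<in> shifted_cells (Suc m) \<longleftrightarrow> ?cell i j" for i j
    by (simp add: shifted_cells_def)
  have bD: "int (Suc m) - int i \<le> b (i, j)" "b (i, j) \<le> int (Suc m)"
    if "b \<in> T_arrays (Suc m)" "?cell i j" for b i j
    using that cells unfolding T_arrays_def by fast+
  have "bij_betw ?to (T_arrays_k (Suc m) k) {c \<in> arrays m. diagonal m c k = 0}"
  proof (rule bij_betw_byWitness[where f' = ?from])
    show "\<forall>b\<in>T_arrays_k (Suc m) k. ?from (?to b) = b"
    proof
      fix b assume "b \<in> T_arrays_k (Suc m) k"
      then have b: "b \<in> T_arrays (Suc m)" by (simp add: T_arrays_k_def)
      then have ext: "b \<in> extensional (shifted_cells (Suc m))" by (simp add: T_arrays_def)
      show "?from (?to b) = b"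
      proof
        fix x :: "nat \<times> nat" obtain i j where x: "x = (i, j)" by (cases x)
        show "?from (?to b) x = b x"
          using bD(2)[OF b, of i j] ext by (auto simp: x extensional_def cells)
      qed
    qed
    show "\<forall>c\<in>{c \<in> arrays m. diagonal m c k = 0}. ?to (?from c) = c"
    proof
      fix c assume "c \<in> {c \<in> arrays m. diagonal m c k = 0}"
      then have c: "c \<in> arrays m" by simp
      show "?to (?from c) = c"
      proof (intro ext)
        fix i j show "?to (?from c) i j = c i j"
          using arraysD(1)[OF c, of i j] by auto
      qed
    qed
    show "?to ` T_arrays_k (Suc m) k \<subseteq> {c \<in> arrays m. diagonal m c k = 0}"
    proof (rule image_subsetI)
      fix b assume bk: "b \<in> T_arrays_k (Suc m) k"
      then have b: "b \<in> T_arrays (Suc m)" by (simp add: T_arrays_k_def)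
      have row: "b (i, j') \<le> b (i, j)" if "1 \<le> i" "i \<le> j" "j \<le> j'" "j' \<le> m" for i j j'
      proof -
        have "?cell i j" "?cell i j'" using that by auto
        then show ?thesis using b that(3) cells unfolding T_arrays_def by blast
      qed
      have col: "b (i', j) \<le> b (i, j)" if "1 \<le> i" "i \<le> i'" "i' \<le> j" "j \<le> m" for i i' j
      proof -
        have "?cell i j" "?cell i' j" using that by auto
        then show ?thesis using b that(2) cells unfolding T_arrays_def by blast
      qed
      have "?to b i j \<le> i" for i j using bD(1)[OF b, of i j] by auto
      moreover have "?to b i j \<le> ?to b i j'" if "1 \<le> i" "i \<le> j" "j \<le> j'" "j' \<le> m" for i j j'
        using row[OF that] that by auto
      moreover have "?to b i j \<le> ?to b i' j" if "1 \<le> i" "i \<le> i'" "i' \<le> j" "j \<le> m" for i i' j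
        using col[OF that] that by auto
      moreover have "?to b i j = 0" if "\<not> ?cell i j" for i j using that by auto
      ultimately have "?to b \<in> arrays m" unfolding arrays_def by blast
      moreover have "diagonal m (?to b) k = 0"
      proof (cases "k < m")
        case True
        then have "?cell (m - k) (m - k)" "int (m - k) \<le> int (Suc m) - 1 - int k" by auto
        then have "b (m - k, m - k) = int (Suc m)"
          using bk cells unfolding T_arrays_k_def by blast
        then show ?thesis by (simp add: diagonal_def)
      qed (simp add: diagonal_def)
      ultimately show "?to b \<in> {c \<in> arrays m. diagonal m c k = 0}" by simp
    qed
    show "?from ` {c \<in> arrays m. diagonal m c k = 0} \<subseteq> T_arrays_k (Suc m) k"
    proof (rule image_subsetI)
      fix c assume "c \<in> {c \<in> arrays m. diagonal m c k = 0}"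
      then have c: "c \<in> arrays m" and d: "diagonal m c k = 0" by auto
      have "?from c \<in> T_arrays (Suc m)"
        unfolding T_arrays_def
        using arraysD(2-4)[OF c] by (auto simp: cells extensional_def)
      moreover have "?from c (i, j) = int (Suc m)"
        if "?cell i j" "int j \<le> int (Suc m) - 1 - int k" for i j
      proof -
        have "c i j \<le> c j j" by (rule arraysD(4)[OF c]) (use that in auto)
        also have "c j j \<le> c (m - k) (m - k)"
        proof -
          have "c j j \<le> c j (m - k)" by (rule arraysD(3)[OF c]) (use that in auto)
          also have "\<dots> \<le> c (m - k) (m - k)" by (rule arraysD(4)[OF c]) (use that in auto)
          finally show ?thesis .
        qed
        also have "c (m - k) (m - k) = 0" using d that by (auto simp: diagonal_def split: if_splits)
        finally show ?thesis using that by simp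
      qed
      ultimately show "?from c \<in> T_arrays_k (Suc m) k"
        unfolding T_arrays_k_def using cells by blast
    qed
  qed
  then show ?thesis by (rule bij_betw_same_card)
qed

text \<open>The condition says that the diagonal has at most \<open>k\<close> nonzero parts, so its
  conjugate has parts of size at most \<open>k\<close>, which corresponds to columns among the first
  \<open>n + k\<close>.\<close>

theorem card_T_arrays_k_eq_sum_row_det:
  assumes "n \<ge> 1" "k \<le> n - 1"
  shows "real (card (T_arrays_k n k)) =
    (\<Sum>I | I \<subseteq> {..<n + k} \<and> card I = n. row_det (map binom_row [0..<n]) I)"
proof -
  obtain m where n: "n = Suc m" using assms(1) by (cases n) auto
  then have k: "k \<le> m" using assms(2) by simp
  have "card (T_arrays_k n k) = card {c \<in> arrays m. diagonal m c k = 0}"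
    unfolding n by (rule card_T_arrays_k[OF k])
  also have "\<dots> = (\<Sum>f\<in>partitions m k. card {c \<in> {c \<in> arrays m. diagonal m c k = 0}. diagonal m c = f})"
    by (rule card_eq_sum_fibres[OF _ finite_partitions])
      (use diagonal_partitions in \<open>auto simp: finite_arrays partitions_def\<close>)
  also have "real \<dots> = (\<Sum>f\<in>partitions m k. shape_det n (transposed f))"
    unfolding of_nat_sum
  proof (rule sum.cong[OF refl])
    fix f assume f: "f \<in> partitions m k"
    then have "{c \<in> {c \<in> arrays m. diagonal m c k = 0}. diagonal m c = f} =
        {c \<in> arrays m. diagonal m c = f}" by (auto simp: partitions_def)
    moreover have "f \<in> partitions m m" using f partitions_mono[OF le_refl k] by blast
    ultimately show "real (card {c \<in> {c \<in> arrays m. diagonal m c k = 0}. diagonal m c = f}) =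
        shape_det n (transposed f)"
      using card_arrays_diagonal n by simp
  qed
  also have "\<dots> = (\<Sum>h\<in>partitions k m. shape_det n h)" by (rule sum_transposed)
  \<comment> \<open>The box gains one row, hence only shapes with \<open>m + 1\<close> nonzero
    parts, whose determinants vanish.\<close>
  also have "\<dots> = (\<Sum>h\<in>partitions k n. shape_det n h)"
  proof (rule sum.mono_neutral_left[OF finite_partitions])
    show "partitions k m \<subseteq> partitions k n" by (rule partitions_mono) (simp_all add: n)
    show "\<forall>h\<in>partitions k n - partitions k m. shape_det n h = 0"
      using shape_det_eq_0_tall by (auto simp: partitions_def n)
  qed
  finally show ?thesis by (simp only: sum_row_det_eq_sum_shape_det)
qed

theorem theorem1p6:
  fixes n k N :: nat
  assumes "n \<ge> 1" and "k \<le> n - 1" and "even N" and "N \<ge> k"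
  shows "((\<lambda>\<epsilon>::real. \<epsilon> powi (- \<lfloor>real k / 2\<rfloor>) *
            pfaffian (four_block_mat
              (0\<^sub>m n n)
              (B_mat n N * J_mat (n + N))
              (- J_mat (n + N) * transpose_mat (B_mat n N))
              (J_mat (n + N) * transpose_mat (L_bar (n + N) n k \<epsilon>) * J_mat (n + N))))
          \<longlongrightarrow> real (card (T_arrays_k n k))) (at 0)"
  unfolding card_T_arrays_k_eq_sum_row_det[OF assms(1,2)]
  by (rule pfaffian_limit[OF assms(3,4)])

end
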